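(* Let $G$ be a finite group with identity $e$ and $|G|=n$, and let $p$ be a probability distribution on $G$ such that the random walk on $G$ generated by $p$ is irreducible. Define $h:G\to\mathbb{R}$ by $h(g):=\mathbf{E}_e[\tau_g]$, which equals $\mathbf{E}_k[\tau_{gk}]$ for every $k\in G$. Let $\rho_1,\ldots,\rho_r$ be the irreducible complex representations of $G$, with $\rho_1$ the trivial representation, and let $d_i$ be the degree of $\rho_i$. Then the Fourier transform $\hat h$ is given by $$\hat h(\rho_i)=-n\,(I-\hat p(\rho_i))^{-1}\quad\text{for } i\neq 1,\qquad \hat h(\rho_1)=-\sum_{i=2}^{r} d_i\,\operatorname{Tr}(\hat h(\rho_i)),$$ where $I$ is the identity matrix of the appropriate dimension (and consequently $h$ is recovered by Fourier inversion, $h(g)=\frac{1}{n}\sum_{i=1}^r d_i\operatorname{Tr}(\rho_i(g^{-1})\hat h(\rho_i))$).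
   Context: The random walk on a finite group $G$ generated by a probability distribution $p$ on $G$ is the discrete-time Markov chain $(X_t)_{t\ge 0}$ with state space $G$ and transition probabilities $P(g,h)=p(hg^{-1})$. It is called irreducible if it is an irreducible Markov chain. For $g\in G$, $\tau_g=\min\{t\ge 0: X_t=g\}$ is the hitting time of $g$, and $\mathbf{E}_k$ denotes expectation for the walk started at $X_0=k$. The list $\rho_1,\dots,\rho_r$ contains one representative (in matrix form) of each isomorphism class of irreducible representations. The Fourier transform of a real-valued function $f$ on $G$ at a representation $\rho$ is the matrix $\hat f(\rho)=\sum_{g\in G} f(g)\rho(g)$. *)

theory Defs
  imports
    "HOL-Probability.Probability"
    "Jordan_Normal_Form.VS_Connect"
begin

fun step_prob :: "'s set \<Rightarrow> ('s \<Rightarrow> 's \<Rightarrow> real) \<Rightarrow> nat \<Rightarrow> 's \<Rightarrow> 's \<Rightarrow> real" where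
  "step_prob S P 0 x y = (if x = y then 1 else 0)"
| "step_prob S P (Suc t) x y = (\<Sum>z\<in>S. P x z * step_prob S P t z y)"

definition irreducible_chain :: "'s set \<Rightarrow> ('s \<Rightarrow> 's \<Rightarrow> real) \<Rightarrow> bool" where
  "irreducible_chain S P \<longleftrightarrow> (\<forall>x\<in>S. \<forall>y\<in>S. \<exists>t. step_prob S P t x y > 0)"

definition markov_chain_from ::
  "'w measure \<Rightarrow> (nat \<Rightarrow> 'w \<Rightarrow> 's) \<Rightarrow> 's set \<Rightarrow> ('s \<Rightarrow> 's \<Rightarrow> real) \<Rightarrow> 's \<Rightarrow> bool" where
  "markov_chain_from M X S P k \<longleftrightarrow>
     prob_space M \<and>
     (\<forall>t. X t \<in> measurable M (count_space S)) \<and>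
     (AE \<omega> in M. X 0 \<omega> = k) \<and>
     (\<forall>t x. (\<forall>i\<le>Suc t. x i \<in> S) \<and> \<P>(\<omega> in M. \<forall>i\<le>t. X i \<omega> = x i) > 0 \<longrightarrow>
        \<P>(\<omega> in M. X (Suc t) \<omega> = x (Suc t) \<bar> \<forall>i\<le>t. X i \<omega> = x i) = P (x t) (x (Suc t)))"

text \<open>The infimum over the empty set is \<open>\<infinity>\<close>.\<close>

definition hitting_time :: "(nat \<Rightarrow> 'w \<Rightarrow> 's) \<Rightarrow> 's \<Rightarrow> 'w \<Rightarrow> enat" where
  "hitting_time X g \<omega> = (INF t\<in>{t. X t \<omega> = g}. enat t)"

definition expected_hitting_time :: "'w measure \<Rightarrow> (nat \<Rightarrow> 'w \<Rightarrow> 's) \<Rightarrow> 's \<Rightarrow> ennreal" where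
  "expected_hitting_time M X g = (\<integral>\<^sup>+ \<omega>. ennreal_of_enat (hitting_time X g \<omega>) \<partial>M)"

definition walk_trans :: "('a, 'b) monoid_scheme \<Rightarrow> 'a pmf \<Rightarrow> 'a \<Rightarrow> 'a \<Rightarrow> real" where
  "walk_trans G p g h = pmf p (h \<otimes>\<^bsub>G\<^esub> inv\<^bsub>G\<^esub> g)"

abbreviation cmat_ring :: "nat \<Rightarrow> complex mat ring" where
  "cmat_ring d \<equiv> ring_mat TYPE(complex) d ()"

text \<open>\<open>units_of (cmat_ring d)\<close> is the general linear group of degree \<open>d\<close>. Values of a
  representation outside \<open>carrier G\<close> are irrelevant.\<close>

definition representation :: "('a, 'b) monoid_scheme \<Rightarrow> nat \<Rightarrow> ('a \<Rightarrow> complex mat) \<Rightarrow> bool" where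
  "representation G d \<rho> \<longleftrightarrow> \<rho> \<in> hom G (units_of (cmat_ring d))"

definition irreducible_representation ::
  "('a, 'b) monoid_scheme \<Rightarrow> nat \<Rightarrow> ('a \<Rightarrow> complex mat) \<Rightarrow> bool" where
  "irreducible_representation G d \<rho> \<longleftrightarrow>
     representation G d \<rho> \<and> d > 0 \<and>
     (\<forall>W. VectorSpace.subspace class_ring W (module_vec TYPE(complex) d) \<and>
          (\<forall>g\<in>carrier G. \<forall>w\<in>W. \<rho> g *\<^sub>v w \<in> W) \<longrightarrow>
          W = {0\<^sub>v d} \<or> W = carrier_vec d)"

definition isomorphic_representations ::
  "('a, 'b) monoid_scheme \<Rightarrow> nat \<Rightarrow> ('a \<Rightarrow> complex mat) \<Rightarrow> nat \<Rightarrow> ('a \<Rightarrow> complex mat) \<Rightarrow> bool" where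
  "isomorphic_representations G d \<rho> d' \<sigma> \<longleftrightarrow>
     d = d' \<and> (\<exists>T\<in>Units (cmat_ring d). \<forall>g\<in>carrier G. T * \<rho> g = \<sigma> g * T)"

text \<open>\<open>\<rho> 1, \<dots>, \<rho> r\<close>, of degrees \<open>d 1, \<dots>, d r\<close>, contain exactly one representative of each
  isomorphism class of irreducible representations.\<close>

definition irreducible_representatives ::
  "('a, 'b) monoid_scheme \<Rightarrow> nat \<Rightarrow> (nat \<Rightarrow> nat) \<Rightarrow> (nat \<Rightarrow> 'a \<Rightarrow> complex mat) \<Rightarrow> bool" where
  "irreducible_representatives G r d \<rho> \<longleftrightarrow>
     (\<forall>i\<in>{1..r}. irreducible_representation G (d i) (\<rho> i)) \<and>
     (\<forall>m \<sigma>. irreducible_representation G m \<sigma> \<longrightarrow>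
        (\<exists>!i. i \<in> {1..r} \<and> isomorphic_representations G (d i) (\<rho> i) m \<sigma>))"

definition trivial_representation ::
  "('a, 'b) monoid_scheme \<Rightarrow> nat \<Rightarrow> ('a \<Rightarrow> complex mat) \<Rightarrow> bool" where
  "trivial_representation G d \<rho> \<longleftrightarrow> d = 1 \<and> (\<forall>g\<in>carrier G. \<rho> g = 1\<^sub>m 1)"

definition fourier ::
  "('a, 'b) monoid_scheme \<Rightarrow> ('a \<Rightarrow> real) \<Rightarrow> nat \<Rightarrow> ('a \<Rightarrow> complex mat) \<Rightarrow> complex mat" where
  "fourier G f d \<rho> = (\<Oplus>\<^bsub>cmat_ring d\<^esub>g\<in>carrier G. complex_of_real (f g) \<cdot>\<^sub>m \<rho> g)"

definition mat_trace :: "complex mat \<Rightarrow> complex" where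
  "mat_trace A = (\<Sum>i<dim_row A. A $$ (i, i))"

end

theory Submission
  imports Defs "Jordan_Normal_Form.Spectral_Radius"
begin

text \<open>
  The walk commutes with right translations, so the mean time from \<open>k\<close> to \<open>g\<close> is \<open>h (g
  k\<^sup>-\<^sup>1)\<close>. Conditioning on the first step of the walk from the identity gives, for \<open>g
  \<noteq> 1\<close>, \<open>h g = 1 + (\<Sum>z. p z * h (g z\<^sup>-\<^sup>1))\<close>. For \<open>g = 1\<close> the
  right-hand side is the mean return time, which by Kac's formula is \<open>n\<close>, because the uniform
  distribution is stationary. Together: \<open>h = 1 + h * p - n \<delta>\<close>, where \<open>*\<close> is
  convolution and \<open>\<delta>\<close> is the indicator of the identity. The Fourier transform turns convolution
  into matrix multiplication and kills constants at every nontrivial irreducible representation, so there \<open>H (I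
  - P) = - n I\<close> for the transforms \<open>H\<close> of \<open>h\<close> and \<open>P\<close> of
  \<open>p\<close>. The value at the trivial representation follows from \<open>h 1 = 0\<close> by Fourier inversion.

  The probabilistic half is \<open>mean_return_time\<close> and \<open>mean_hitting_time_first_step\<close>. One
  telescoping sum carries both finiteness and Kac's formula. Let \<open>Z t\<close> be the sum over all starting
  states of the probability of avoiding \<open>g\<close> up to time \<open>t\<close>. Stationarity of the uniform
  distribution makes \<open>Z t - Z (t + 1)\<close> the probability that, after leaving \<open>g\<close>, the chain
  avoids \<open>g\<close> for the following \<open>t + 1\<close> times. These differences sum to at most \<open>Z 0 =
  n - 1\<close>, hence the mean return time is finite; by irreducibility all mean hitting times of \<open>g\<close>
  are finite, so \<open>Z t\<close> tends to \<open>0\<close> and the sum is exactly \<open>n - 1\<close>.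

  The algebraic half is \<open>fourier_inversion\<close>, which rests on \<open>regular_character\<close>: the sum of
  the irreducible characters weighted by their degrees is \<open>n \<delta>\<close>. By Schur orthogonality both sides
  have the same Fourier transform, so it suffices that a function with vanishing transform is zero
  (\<open>fourier_injective\<close>). The conjugates of such functions form a translation-invariant space, and if it
  is nonzero it contains an irreducible representation acting by right translation. Its elements are matrix
  coefficients of that representation, and yet orthogonal to all of them, hence zero.
\<close>

unbundle no vec_syntax

section \<open>Matrices and invariant subspaces\<close>

definition inj_mat :: "complex mat \<Rightarrow> bool" where
  "inj_mat B \<longleftrightarrow> (\<forall>v\<in>carrier_vec (dim_col B). B *\<^sub>v v = 0\<^sub>v (dim_row B) \<longrightarrow> v = 0\<^sub>v (dim_col B))"

lemma inj_matD:
  assumes "inj_mat B" "B \<in> carrier_mat m k" "v \<in> carrier_vec k" "B *\<^sub>v v = 0\<^sub>v m"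
  shows "v = 0\<^sub>v k"
  using assms unfolding inj_mat_def by auto

lemma inj_mat_cancel:
  assumes "inj_mat B" and B: "B \<in> carrier_mat m k"
    and C: "C \<in> carrier_mat k l" and D: "D \<in> carrier_mat k l" and eq: "B * C = B * D"
  shows "C = D"
proof (rule mat_col_eqI)
  fix j assume "j < dim_col D"
  hence j: "j < l" using D by auto
  have cc: "col C j \<in> carrier_vec k" "col D j \<in> carrier_vec k" using C D j by auto
  have "col (B * C) j = col (B * D) j" using eq by simp
  hence "B *\<^sub>v col C j = B *\<^sub>v col D j"
    using col_mult2[OF B C j] col_mult2[OF B D j] by simp
  hence "B *\<^sub>v (col C j - col D j) = 0\<^sub>v m"
    using B cc by (simp add: mult_minus_distrib_mat_vec)
  hence z: "col C j - col D j = 0\<^sub>v k" 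
    using inj_matD[OF assms(1) B] cc by simp
  show "col C j = col D j"
  proof (rule eq_vecI)
    fix i assume "i < dim_vec (col D j)"
    hence "i < k" using cc D by auto
    hence "(col C j - col D j) $ i = 0" using z by simp
    thus "col C j $ i = col D j $ i" using \<open>i < k\<close> C D j by auto
  qed (use C D in auto)
qed (use C D in auto)

lemma mat_factor_of_cols:
  fixes A :: "complex mat"
  assumes A: "A \<in> carrier_mat m k" and B: "B \<in> carrier_mat m l"
    and cols: "\<And>j. j < k \<Longrightarrow> \<exists>v\<in>carrier_vec l. col A j = B *\<^sub>v v"
  shows "\<exists>C\<in>carrier_mat l k. A = B * C"
proof -
  from cols obtain f where f: "\<And>j. j < k \<Longrightarrow> f j \<in> carrier_vec l \<and> col A j = B *\<^sub>v f j"
    by metis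
  let ?C = "mat_of_cols l (map f [0..<k])"
  have C: "?C \<in> carrier_mat l k" using mat_of_cols_carrier(1)[of l "map f [0..<k]"] by simp
  have "A = B * ?C"
  proof (rule mat_col_eqI)
    fix j assume "j < dim_col (B * ?C)"
    hence j: "j < k" by simp
    have "col ?C j = f j" using j f[OF j] by (simp add: col_mat_of_cols)
    thus "col A j = col (B * ?C) j" using col_mult2[OF B C j] f[OF j] by simp
  qed (use A B in auto)
  with C show ?thesis by blast
qed

text \<open>
  Padded with zero rows to a square matrix, a matrix with more columns than rows becomes singular and keeps its
  kernel.
\<close>

lemma inj_mat_dim_le:
  assumes "inj_mat B" "B \<in> carrier_mat m k"
  shows "k \<le> m"
proof (rule ccontr)
  assume "\<not> k \<le> m"
  hence mk: "m < k" by simp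
  define P where "P = mat k k (\<lambda>(i,j). if i < m then B $$ (i,j) else 0)"
  have P: "P \<in> carrier_mat k k" unfolding P_def by simp
  have "row P m = 0\<^sub>v k" using mk by (intro eq_vecI) (auto simp: P_def)
  have "det P = 0"
  proof (rule ccontr)
    assume "det P \<noteq> 0"
    from det_non_zero_imp_unit[OF P this, of "()"] obtain Q where
      Q: "Q \<in> carrier_mat k k" "P * Q = 1\<^sub>m k"
      by (auto simp: Units_def ring_mat_simps)
    have "(P * Q) $$ (m, m) = 0" using \<open>row P m = 0\<^sub>v k\<close> P Q(1) mk by simp
    thus False using Q(2) mk by simp
  qed
  then obtain v where v: "v \<in> carrier_vec k" "v \<noteq> 0\<^sub>v k" "P *\<^sub>v v = 0\<^sub>v k"
    using det_0_iff_vec_prod_zero_field[OF P] by blast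
  have "B *\<^sub>v v = 0\<^sub>v m"
  proof (rule eq_vecI)
    fix i assume "i < dim_vec (0\<^sub>v m :: complex vec)"
    hence i: "i < m" by simp
    have "row B i = row P i" using i mk assms(2) by (intro eq_vecI) (auto simp: P_def)
    hence "(B *\<^sub>v v) $ i = (P *\<^sub>v v) $ i" using i mk assms(2) P by simp
    thus "(B *\<^sub>v v) $ i = 0\<^sub>v m $ i" using v(3) i mk by simp
  qed (use assms in auto)
  with inj_matD[OF assms v(1)] v(2) show False by simp
qed

lemma inj_mat_square_surj:
  assumes "inj_mat B" and B: "B \<in> carrier_mat m m" and u: "u \<in> carrier_vec m"
  shows "\<exists>v\<in>carrier_vec m. u = B *\<^sub>v v"
proof -
  have "det B \<noteq> 0" using det_0_iff_vec_prod_zero_field[OF B] inj_matD[OF assms(1) B] by blast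
  from det_non_zero_imp_unit[OF B this, of "()"] obtain Q where
    Q: "Q \<in> carrier_mat m m" "B * Q = 1\<^sub>m m" by (auto simp: Units_def ring_mat_simps)
  have "u = B *\<^sub>v (Q *\<^sub>v u)" using assoc_mult_mat_vec[OF B Q(1) u] Q(2) u by simp
  thus ?thesis using Q(1) u by (metis mult_mat_vec_carrier)
qed

abbreviation vec_subspace :: "nat \<Rightarrow> complex vec set \<Rightarrow> bool" where
  "vec_subspace m W \<equiv> VectorSpace.subspace class_ring W (module_vec TYPE(complex) m)"

lemma vec_subspace_iff:
  "vec_subspace m W \<longleftrightarrow> W \<subseteq> carrier_vec m \<and> 0\<^sub>v m \<in> W \<and>
     (\<forall>v\<in>W. \<forall>w\<in>W. v + w \<in> W) \<and> (\<forall>c. \<forall>v\<in>W. c \<cdot>\<^sub>v v \<in> W)"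
  using vec_vs[where 'a = complex and n = m] vec_module[where 'a = complex and n = m]
  unfolding VectorSpace.subspace_def submodule_def
  by (auto simp: module_vec_simps)

text \<open>
  A linearly independent family stays independent when a vector outside its span is added.
\<close>

lemma inj_mat_append_col:
  assumes "inj_mat B" and B: "B \<in> carrier_mat m k" and u: "u \<in> carrier_vec m"
    and new: "\<And>v. v \<in> carrier_vec k \<Longrightarrow> u \<noteq> B *\<^sub>v v"
  defines "C \<equiv> mat m (Suc k) (\<lambda>(i,j). if j < k then B $$ (i,j) else u $ i)"
  shows "inj_mat C"
    and "\<And>v. v \<in> carrier_vec (Suc k) \<Longrightarrow> C *\<^sub>v v = B *\<^sub>v vec k (($) v) + v $ k \<cdot>\<^sub>v u"
proof -
  show expand: "C *\<^sub>v v = B *\<^sub>v vec k (($) v) + v $ k \<cdot>\<^sub>v u" if v: "v \<in> carrier_vec (Suc k)" for v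
  proof (rule eq_vecI)
    fix i assume "i < dim_vec (B *\<^sub>v vec k (($) v) + v $ k \<cdot>\<^sub>v u)"
    hence i: "i < m" using u by simp
    thus "(C *\<^sub>v v) $ i = (B *\<^sub>v vec k (($) v) + v $ k \<cdot>\<^sub>v u) $ i"
      using v u B by (simp add: C_def scalar_prod_def)
  qed (use u in \<open>auto simp: C_def\<close>)
  have C: "dim_row C = m" "dim_col C = Suc k" by (auto simp: C_def)
  show "inj_mat C" unfolding inj_mat_def C
  proof (intro ballI impI)
    fix v assume v: "v \<in> carrier_vec (Suc k)" and z: "C *\<^sub>v v = 0\<^sub>v m"
    let ?w = "vec k (($) v)"
    have w: "?w \<in> carrier_vec k" by simp
    have z': "B *\<^sub>v ?w + v $ k \<cdot>\<^sub>v u = 0\<^sub>v m" using z expand[OF v] by simp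
    have vk: "v $ k = 0"
    proof (rule ccontr)
      assume nz: "v $ k \<noteq> 0"
      have "u = B *\<^sub>v ((- 1 / v $ k) \<cdot>\<^sub>v ?w)"
      proof (rule eq_vecI)
        fix i assume "i < dim_vec (B *\<^sub>v ((- 1 / v $ k) \<cdot>\<^sub>v ?w))"
        hence i: "i < m" using B by simp
        have "(B *\<^sub>v ?w + v $ k \<cdot>\<^sub>v u) $ i = 0" using z' i by simp
        hence e: "(B *\<^sub>v ?w) $ i = - (v $ k * u $ i)" using i u B
          by (simp add: eq_neg_iff_add_eq_0)
        have "(B *\<^sub>v ((- 1 / v $ k) \<cdot>\<^sub>v ?w)) $ i = (- 1 / v $ k) * (B *\<^sub>v ?w) $ i"
          using B i by (subst mult_mat_vec[OF B]) auto
        thus "u $ i = (B *\<^sub>v ((- 1 / v $ k) \<cdot>\<^sub>v ?w)) $ i" using nz unfolding e by simp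
      qed (use B u in auto)
      with new[of "(- 1 / v $ k) \<cdot>\<^sub>v ?w"] show False by simp
    qed
    have "0 \<cdot>\<^sub>v u = 0\<^sub>v m" using u by auto
    hence "B *\<^sub>v ?w = 0\<^sub>v m" using z' vk B by (metis mult_mat_vec_carrier right_zero_vec w)
    hence w0: "?w = 0\<^sub>v k" using inj_matD[OF assms(1) B] by simp
    show "v = 0\<^sub>v (Suc k)"
    proof (rule eq_vecI)
      fix i assume "i < dim_vec (0\<^sub>v (Suc k) :: complex vec)"
      hence "i < k \<or> i = k" by auto
      thus "v $ i = 0\<^sub>v (Suc k) $ i"
      proof
        assume "i < k"
        hence "?w $ i = 0" using w0 by simp
        thus ?thesis using \<open>i < k\<close> by simp
      qed (use vk in auto)
    qed (use v in auto)
  qed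
qed

text \<open>
  The columns of \<open>B\<close> form a basis of \<open>W\<close>: take an independent family in \<open>W\<close> of
  greatest length, to which no vector of \<open>W\<close> can be appended. Describing subspaces by injective matrices
  turns statements about restricted actions into matrix factorizations.
\<close>

lemma subspace_basis_mat:
  assumes W: "vec_subspace m W"
  shows "\<exists>k B. B \<in> carrier_mat m k \<and> inj_mat B \<and> W = (\<lambda>v. B *\<^sub>v v) ` carrier_vec k"
proof -
  let ?P = "\<lambda>k. \<exists>B\<in>carrier_mat m k. inj_mat B \<and> (\<forall>v\<in>carrier_vec k. B *\<^sub>v v \<in> W)"
  have W': "W \<subseteq> carrier_vec m" "0\<^sub>v m \<in> W" "\<And>v w. v \<in> W \<Longrightarrow> w \<in> W \<Longrightarrow> v + w \<in> W"
    "\<And>c v. v \<in> W \<Longrightarrow> c \<cdot>\<^sub>v v \<in> W" using W unfolding vec_subspace_iff by auto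
  have "mat m 0 (\<lambda>_. 0) *\<^sub>v v = 0\<^sub>v m" if "v \<in> carrier_vec 0" for v :: "complex vec"
    using that by (intro eq_vecI) (auto simp: scalar_prod_def)
  hence "?P 0" using W'(2) by (intro bexI[of _ "mat m 0 (\<lambda>_. 0)"]) (auto simp: inj_mat_def)
  moreover have bound: "k \<le> m" if "?P k" for k using that inj_mat_dim_le by blast
  ultimately have "?P (GREATEST k. ?P k)" by (intro GreatestI_nat[where P = ?P and b = m]) auto
  then obtain k B where k: "k = (GREATEST k. ?P k)" and B: "B \<in> carrier_mat m k" "inj_mat B"
    and im: "\<And>v. v \<in> carrier_vec k \<Longrightarrow> B *\<^sub>v v \<in> W" by auto
  have "u \<in> (\<lambda>v. B *\<^sub>v v) ` carrier_vec k" if u: "u \<in> W" for u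
  proof (rule ccontr)
    assume "u \<notin> (\<lambda>v. B *\<^sub>v v) ` carrier_vec k"
    hence new: "\<And>v. v \<in> carrier_vec k \<Longrightarrow> u \<noteq> B *\<^sub>v v" by auto
    have uc: "u \<in> carrier_vec m" using u W'(1) by auto
    let ?C = "mat m (Suc k) (\<lambda>(i,j). if j < k then B $$ (i,j) else u $ i)"
    note C = inj_mat_append_col[OF B(2,1) uc new]
    have "?P (Suc k)"
      using C im W'(3,4) u by (intro bexI[of _ ?C]) auto
    hence "Suc k \<le> (GREATEST k. ?P k)" using bound by (intro Greatest_le_nat[where b = m]) auto
    thus False using k by simp
  qed
  with B im show ?thesis by (intro exI[of _ k] exI[of _ B]) auto
qed

lemma mat_mult_index:
  fixes A B :: "complex mat"
  assumes "A \<in> carrier_mat m k" "B \<in> carrier_mat k l" "i < m" "j < l"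
  shows "(A * B) $$ (i,j) = (\<Sum>x<k. A $$ (i,x) * B $$ (x,j))"
  using assms by (auto simp: scalar_prod_def atLeast0LessThan intro!: sum.cong)

lemma trace_mult_comm:
  fixes A B :: "complex mat"
  assumes "A \<in> carrier_mat m k" "B \<in> carrier_mat k m"
  shows "mat_trace (A * B) = mat_trace (B * A)"
proof -
  have "mat_trace (A * B) = (\<Sum>i<m. \<Sum>j<k. A $$ (i,j) * B $$ (j,i))"
    using assms by (auto simp: mat_trace_def scalar_prod_def atLeast0LessThan intro!: sum.cong)
  also have "\<dots> = (\<Sum>j<k. \<Sum>i<m. A $$ (i,j) * B $$ (j,i))" by (rule sum.swap)
  also have "\<dots> = mat_trace (B * A)"
    using assms by (auto simp: mat_trace_def scalar_prod_def atLeast0LessThan mult.commute intro!: sum.cong)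
  finally show ?thesis .
qed

text \<open>
  Both identity matrices have the same trace, since \<open>T * S\<close> and \<open>S * T\<close> do.
\<close>

lemma two_sided_inverse_square:
  fixes T S :: "complex mat"
  assumes "T \<in> carrier_mat d d'" "S \<in> carrier_mat d' d" "T * S = 1\<^sub>m d" "S * T = 1\<^sub>m d'"
  shows "d = d'"
proof -
  have "mat_trace (1\<^sub>m d) = mat_trace (1\<^sub>m d')"
    using trace_mult_comm[OF assms(1,2)] assms(3,4) by simp
  thus ?thesis by (simp add: mat_trace_def)
qed

lemma cmat_Units_iff:
  "A \<in> Units (cmat_ring d) \<longleftrightarrow>
     A \<in> carrier_mat d d \<and> (\<exists>B\<in>carrier_mat d d. A * B = 1\<^sub>m d \<and> B * A = 1\<^sub>m d)"
  by (auto simp: Units_def ring_mat_simps)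

text \<open>
  The shape is a parameter because matrices of all shapes share one type, in which no element is neutral for addition.
\<close>

definition sum_mat :: "nat \<Rightarrow> nat \<Rightarrow> 'i set \<Rightarrow> ('i \<Rightarrow> complex mat) \<Rightarrow> complex mat" where
  "sum_mat m k I F = mat m k (\<lambda>(a,b). \<Sum>i\<in>I. F i $$ (a,b))"

lemma sum_mat_carrier [simp]:
  "sum_mat m k I F \<in> carrier_mat m k" "dim_row (sum_mat m k I F) = m" "dim_col (sum_mat m k I F) = k"
  unfolding sum_mat_def by auto

lemma sum_mat_index [simp]:
  "a < m \<Longrightarrow> b < k \<Longrightarrow> sum_mat m k I F $$ (a,b) = (\<Sum>i\<in>I. F i $$ (a,b))"
  unfolding sum_mat_def by simp

lemma sum_mat_cong:
  "(\<And>i. i \<in> I \<Longrightarrow> F i = H i) \<Longrightarrow> sum_mat m k I F = sum_mat m k I H"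
  unfolding sum_mat_def by simp

lemma sum_mat_reindex:
  assumes "bij_betw \<phi> I J"
  shows "sum_mat m k I (\<lambda>i. F (\<phi> i)) = sum_mat m k J F"
proof (rule eq_matI)
  fix a b assume "a < dim_row (sum_mat m k J F)" "b < dim_col (sum_mat m k J F)"
  thus "sum_mat m k I (\<lambda>i. F (\<phi> i)) $$ (a, b) = sum_mat m k J F $$ (a, b)"
    using sum.reindex_bij_betw[OF assms, of "\<lambda>i. F i $$ (a,b)"] by simp
qed auto

lemma mult_sum_mat:
  assumes A: "A \<in> carrier_mat l m" and F: "\<And>i. i \<in> I \<Longrightarrow> F i \<in> carrier_mat m k"
  shows "A * sum_mat m k I F = sum_mat l k I (\<lambda>i. A * F i)"
proof (rule eq_matI)
  fix a b assume "a < dim_row (sum_mat l k I (\<lambda>i. A * F i))" "b < dim_col (sum_mat l k I (\<lambda>i. A * F i))"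
  hence ab: "a < l" "b < k" by auto
  have "(A * sum_mat m k I F) $$ (a,b) = (\<Sum>j<m. \<Sum>i\<in>I. A $$ (a,j) * F i $$ (j,b))"
    using ab A by (auto simp: scalar_prod_def sum_distrib_left atLeast0LessThan intro!: sum.cong)
  also have "\<dots> = (\<Sum>i\<in>I. \<Sum>j<m. A $$ (a,j) * F i $$ (j,b))" by (rule sum.swap)
  also have "\<dots> = (\<Sum>i\<in>I. (A * F i) $$ (a,b))"
  proof (rule sum.cong)
    fix i assume "i \<in> I"
    from F[OF this] show "(\<Sum>j<m. A $$ (a,j) * F i $$ (j,b)) = (A * F i) $$ (a,b)"
      using ab A by (auto simp: scalar_prod_def atLeast0LessThan intro!: sum.cong)
  qed simp
  finally show "(A * sum_mat m k I F) $$ (a,b) = sum_mat l k I (\<lambda>i. A * F i) $$ (a,b)"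
    using ab by simp
qed (use A in auto)

lemma sum_mat_mult:
  assumes A: "A \<in> carrier_mat k l" and F: "\<And>i. i \<in> I \<Longrightarrow> F i \<in> carrier_mat m k"
  shows "sum_mat m k I F * A = sum_mat m l I (\<lambda>i. F i * A)"
proof (rule eq_matI)
  fix a b assume "a < dim_row (sum_mat m l I (\<lambda>i. F i * A))" "b < dim_col (sum_mat m l I (\<lambda>i. F i * A))"
  hence ab: "a < m" "b < l" by auto
  have "(sum_mat m k I F * A) $$ (a,b) = (\<Sum>j<k. \<Sum>i\<in>I. F i $$ (a,j) * A $$ (j,b))"
    using ab A by (auto simp: scalar_prod_def sum_distrib_right atLeast0LessThan intro!: sum.cong)
  also have "\<dots> = (\<Sum>i\<in>I. \<Sum>j<k. F i $$ (a,j) * A $$ (j,b))" by (rule sum.swap)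
  also have "\<dots> = (\<Sum>i\<in>I. (F i * A) $$ (a,b))"
  proof (rule sum.cong)
    fix i assume "i \<in> I"
    from F[OF this] show "(\<Sum>j<k. F i $$ (a,j) * A $$ (j,b)) = (F i * A) $$ (a,b)"
      using ab A by (auto simp: scalar_prod_def atLeast0LessThan intro!: sum.cong)
  qed simp
  finally show "(sum_mat m k I F * A) $$ (a,b) = sum_mat m l I (\<lambda>i. F i * A) $$ (a,b)"
    using ab by simp
qed (use A in auto)

lemma mat_trace_sum_mat:
  assumes "\<And>i. i \<in> I \<Longrightarrow> F i \<in> carrier_mat m m"
  shows "mat_trace (sum_mat m m I F) = (\<Sum>i\<in>I. mat_trace (F i))"
proof -
  have "mat_trace (sum_mat m m I F) = (\<Sum>a<m. \<Sum>i\<in>I. F i $$ (a,a))"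
    unfolding mat_trace_def by simp
  also have "\<dots> = (\<Sum>i\<in>I. \<Sum>a<m. F i $$ (a,a))" by (rule sum.swap)
  also have "\<dots> = (\<Sum>i\<in>I. mat_trace (F i))"
    using assms by (intro sum.cong) (auto simp: mat_trace_def)
  finally show ?thesis .
qed

text \<open>
  \<open>E\<close> is a matrix unit. It isolates a single coefficient of each factor, and so turns statements about
  averages \<open>\<Sum>g. \<rho> (inv g) * E * \<sigma> g\<close> into orthogonality relations between coefficients.
\<close>

lemma matrix_unit_sandwich:
  fixes A B :: "complex mat"
  assumes A: "A \<in> carrier_mat m d" and B: "B \<in> carrier_mat d' l"
    and "a < d" "b < d'" "i < m" "j < l"
  defines "E \<equiv> mat d d' (\<lambda>(x,y). if x = a \<and> y = b then 1 else 0)"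
  shows "(A * E * B) $$ (i,j) = A $$ (i,a) * B $$ (b,j)"
proof -
  have AE: "(A * E) $$ (i,y) = (if y = b then A $$ (i,a) else 0)" if "y < d'" for y
  proof -
    have "(A * E) $$ (i,y) = (\<Sum>x<d. A $$ (i,x) * E $$ (x,y))"
      using that assms by (auto simp: scalar_prod_def atLeast0LessThan intro!: sum.cong)
    also have "\<dots> = (\<Sum>x<d. if x = a then (if y = b then A $$ (i,x) else 0) else 0)"
      using that by (intro sum.cong) (auto simp: E_def)
    finally show ?thesis using assms(3) by simp
  qed
  have "(A * E * B) $$ (i,j) = (\<Sum>y<d'. (A * E) $$ (i,y) * B $$ (y,j))"
    using assms by (auto simp: E_def scalar_prod_def atLeast0LessThan intro!: sum.cong)
  also have "\<dots> = (\<Sum>y<d'. if y = b then A $$ (i,a) * B $$ (y,j) else 0)"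
    by (intro sum.cong) (auto simp: AE)
  finally show ?thesis using assms(4) by simp
qed

text \<open>
  Coefficients of \<open>M * F x * N\<close> are combinations of those of \<open>F x\<close> with factors that do not
  depend on \<open>x\<close>, so linear relations among the latter pass to the former.
\<close>

lemma weighted_sum_sandwich_zero:
  fixes w :: "'i \<Rightarrow> complex"
  assumes M: "M \<in> carrier_mat p d" and N: "N \<in> carrier_mat d' q"
    and F: "\<And>x. x \<in> I \<Longrightarrow> F x \<in> carrier_mat d d'"
    and zero: "\<And>a b. a < d \<Longrightarrow> b < d' \<Longrightarrow> (\<Sum>x\<in>I. w x * F x $$ (a,b)) = 0"
    and ij: "i < p" "j < q"
  shows "(\<Sum>x\<in>I. w x * (M * F x * N) $$ (i,j)) = 0"
proof -
  have entry: "(M * F x * N) $$ (i,j) = (\<Sum>b<d'. \<Sum>a<d. M $$ (i,a) * F x $$ (a,b) * N $$ (b,j))"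
    if x: "x \<in> I" for x
  proof -
    have "(M * F x) $$ (i,b) = (\<Sum>a<d. M $$ (i,a) * F x $$ (a,b))" if "b < d'" for b
      by (rule mat_mult_index[OF M F[OF x] ij(1) that])
    moreover have "(M * F x * N) $$ (i,j) = (\<Sum>b<d'. (M * F x) $$ (i,b) * N $$ (b,j))"
      by (rule mat_mult_index[OF mult_carrier_mat[OF M F[OF x]] N ij])
    ultimately show ?thesis by (simp add: sum_distrib_right)
  qed
  have "(\<Sum>x\<in>I. w x * (M * F x * N) $$ (i,j)) =
      (\<Sum>x\<in>I. \<Sum>b<d'. \<Sum>a<d. M $$ (i,a) * N $$ (b,j) * (w x * F x $$ (a,b)))"
    by (intro sum.cong) (auto simp: entry sum_distrib_left mult_ac)
  also have "\<dots> = (\<Sum>b<d'. \<Sum>x\<in>I. \<Sum>a<d. M $$ (i,a) * N $$ (b,j) * (w x * F x $$ (a,b)))"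
    by (rule sum.swap)
  also have "\<dots> = (\<Sum>b<d'. \<Sum>a<d. \<Sum>x\<in>I. M $$ (i,a) * N $$ (b,j) * (w x * F x $$ (a,b)))"
    by (intro sum.cong refl sum.swap)
  also have "\<dots> = (\<Sum>b<d'. \<Sum>a<d. M $$ (i,a) * N $$ (b,j) * (\<Sum>x\<in>I. w x * F x $$ (a,b)))"
    by (simp add: sum_distrib_left)
  also have "\<dots> = 0" using zero by (intro sum.neutral ballI) auto
  finally show ?thesis .
qed

context group
begin

section \<open>Schur's lemma and Schur orthogonality\<close>

text \<open>
  Multiplicativity makes \<open>\<rho> (inv g)\<close> an inverse of \<open>\<rho> g\<close>, hence invertibility of
  the values can be traded for the condition at the identity.
\<close>

lemma representation_iff:
  "representation G d \<rho> \<longleftrightarrow>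
     (\<forall>g\<in>carrier G. \<rho> g \<in> carrier_mat d d) \<and> \<rho> \<one> = 1\<^sub>m d \<and>
     (\<forall>g\<in>carrier G. \<forall>h\<in>carrier G. \<rho> (g \<otimes> h) = \<rho> g * \<rho> h)" (is "?L \<longleftrightarrow> ?R")
proof
  interpret R: ring "cmat_ring d" by (rule ring_mat)
  interpret U: group "units_of (cmat_ring d)" by (rule R.units_group)
  assume ?L
  hence hom: "\<rho> \<in> hom G (units_of (cmat_ring d))" unfolding representation_def .
  have "group_hom G (units_of (cmat_ring d)) \<rho>"
    using hom by (simp add: group_hom_def group_hom_axioms_def is_group U.is_group)
  hence "\<rho> \<one> = \<one>\<^bsub>units_of (cmat_ring d)\<^esub>" by (rule group_hom.hom_one)
  hence "\<rho> \<one> = 1\<^sub>m d" by (simp add: units_of_def ring_mat_simps)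
  moreover have "\<rho> g \<in> carrier_mat d d" if "g \<in> carrier G" for g
    using hom that unfolding hom_def by (auto simp: units_of_def cmat_Units_iff)
  moreover have "\<rho> (g \<otimes> h) = \<rho> g * \<rho> h" if "g \<in> carrier G" "h \<in> carrier G" for g h
    using hom that unfolding hom_def by (auto simp: units_of_def ring_mat_simps)
  ultimately show ?R by blast
next
  assume R: ?R
  have "\<rho> g \<in> Units (cmat_ring d)" if g: "g \<in> carrier G" for g
    unfolding cmat_Units_iff
  proof (intro conjI bexI[of _ "\<rho> (inv g)"])
    show "\<rho> g * \<rho> (inv g) = 1\<^sub>m d" "\<rho> (inv g) * \<rho> g = 1\<^sub>m d"
      using R g by (metis inv_closed r_inv, metis inv_closed l_inv)
  qed (use R g in auto)
  thus ?L using R unfolding representation_def hom_def by (auto simp: units_of_def ring_mat_simps)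
qed

lemma representation_carrier:
  "representation G d \<rho> \<Longrightarrow> g \<in> carrier G \<Longrightarrow> \<rho> g \<in> carrier_mat d d"
  by (simp add: representation_iff)

lemma representation_mult:
  "representation G d \<rho> \<Longrightarrow> g \<in> carrier G \<Longrightarrow> h \<in> carrier G \<Longrightarrow> \<rho> (g \<otimes> h) = \<rho> g * \<rho> h"
  by (simp add: representation_iff)

lemma irreducible_representationD:
  assumes "irreducible_representation G d \<rho>"
  shows "representation G d \<rho>" "d > 0"
    and "\<And>W. vec_subspace d W \<Longrightarrow> (\<And>g w. g \<in> carrier G \<Longrightarrow> w \<in> W \<Longrightarrow> \<rho> g *\<^sub>v w \<in> W) \<Longrightarrow>
      W = {0\<^sub>v d} \<or> W = carrier_vec d"
  using assms unfolding irreducible_representation_def by blast+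

lemma kernel_invariant_subspace:
  assumes \<sigma>: "representation G d' \<sigma>" and T: "T \<in> carrier_mat d d'" and \<rho>: "representation G d \<rho>"
    and comm: "\<And>g. g \<in> carrier G \<Longrightarrow> \<rho> g * T = T * \<sigma> g"
  defines "W \<equiv> {w \<in> carrier_vec d'. T *\<^sub>v w = 0\<^sub>v d}"
  shows "vec_subspace d' W" "\<And>g w. g \<in> carrier G \<Longrightarrow> w \<in> W \<Longrightarrow> \<sigma> g *\<^sub>v w \<in> W"
proof -
  show "vec_subspace d' W"
    unfolding vec_subspace_iff W_def using T
    by (auto simp: mult_add_distrib_mat_vec mult_mat_vec)
  fix g w assume g: "g \<in> carrier G" and w: "w \<in> W"
  have \<sigma>g: "\<sigma> g \<in> carrier_mat d' d'" and \<rho>g: "\<rho> g \<in> carrier_mat d d"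
    using representation_carrier \<sigma> \<rho> g by auto
  have "T *\<^sub>v (\<sigma> g *\<^sub>v w) = (T * \<sigma> g) *\<^sub>v w"
    using T \<sigma>g w by (auto simp: W_def)
  also have "\<dots> = \<rho> g *\<^sub>v (T *\<^sub>v w)"
    using T \<rho>g w comm[OF g, symmetric] by (auto simp: W_def)
  also have "\<dots> = 0\<^sub>v d" using w \<rho>g by (auto simp: W_def)
  finally show "\<sigma> g *\<^sub>v w \<in> W" using w \<sigma>g by (auto simp: W_def)
qed

lemma image_invariant_subspace:
  assumes \<sigma>: "representation G d' \<sigma>" and T: "T \<in> carrier_mat d d'" and \<rho>: "representation G d \<rho>"
    and comm: "\<And>g. g \<in> carrier G \<Longrightarrow> \<rho> g * T = T * \<sigma> g"
  defines "W \<equiv> (\<lambda>v. T *\<^sub>v v) ` carrier_vec d'"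
  shows "vec_subspace d W" "\<And>g w. g \<in> carrier G \<Longrightarrow> w \<in> W \<Longrightarrow> \<rho> g *\<^sub>v w \<in> W"
proof -
  have "0\<^sub>v d \<in> W" unfolding W_def using T by (intro image_eqI[of _ _ "0\<^sub>v d'"]) auto
  moreover have "v + w \<in> W" if vw: "v \<in> W" "w \<in> W" for v w
  proof -
    from vw obtain v' w' where "v' \<in> carrier_vec d'" "w' \<in> carrier_vec d'"
      "v = T *\<^sub>v v'" "w = T *\<^sub>v w'" by (auto simp: W_def)
    thus ?thesis unfolding W_def using T
      by (intro image_eqI[of _ _ "v' + w'"]) (auto simp: mult_add_distrib_mat_vec)
  qed
  moreover have "c \<cdot>\<^sub>v v \<in> W" if v: "v \<in> W" for c v
  proof -
    from v obtain v' where "v' \<in> carrier_vec d'" "v = T *\<^sub>v v'" by (auto simp: W_def)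
    thus ?thesis unfolding W_def using T
      by (intro image_eqI[of _ _ "c \<cdot>\<^sub>v v'"]) (auto simp: mult_mat_vec)
  qed
  ultimately show "vec_subspace d W" unfolding vec_subspace_iff using T by (auto simp: W_def)
  fix g w assume g: "g \<in> carrier G" and "w \<in> W"
  then obtain v where v: "v \<in> carrier_vec d'" "w = T *\<^sub>v v" by (auto simp: W_def)
  have \<sigma>g: "\<sigma> g \<in> carrier_mat d' d'" and \<rho>g: "\<rho> g \<in> carrier_mat d d"
    using representation_carrier \<sigma> \<rho> g by auto
  have "\<rho> g *\<^sub>v w = (\<rho> g * T) *\<^sub>v v" using v T \<rho>g by auto
  also have "\<dots> = T *\<^sub>v (\<sigma> g *\<^sub>v v)" using comm[OF g] T \<sigma>g v by auto
  finally show "\<rho> g *\<^sub>v w \<in> W" unfolding W_def using \<sigma>g v by (metis image_eqI mult_mat_vec_carrier)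
qed

text \<open>
  The kernel and the image of an intertwiner are invariant subspaces, so irreducibility makes a nonzero one injective
  and surjective. The inverse is constructed before it is known that the two degrees agree; their equality then
  follows from the existence of \<open>S\<close>.
\<close>

lemma schur_intertwiner_invertible:
  assumes \<rho>: "irreducible_representation G d \<rho>" and \<sigma>: "irreducible_representation G d' \<sigma>"
    and T: "T \<in> carrier_mat d d'" and comm: "\<And>g. g \<in> carrier G \<Longrightarrow> \<rho> g * T = T * \<sigma> g"
    and nz: "T \<noteq> 0\<^sub>m d d'"
  shows "\<exists>S\<in>carrier_mat d' d. T * S = 1\<^sub>m d \<and> S * T = 1\<^sub>m d'"
proof -
  note \<rho>' = irreducible_representationD[OF \<rho>] and \<sigma>' = irreducible_representationD[OF \<sigma>]
  have unit: "T *\<^sub>v unit_vec d' j = col T j" if "j < d'" for j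
    using T that by (intro eq_vecI) auto
  have nzcol: "\<exists>j<d'. col T j \<noteq> 0\<^sub>v d"
  proof (rule ccontr)
    assume "\<not> ?thesis"
    hence "T = 0\<^sub>m d d'" using T by (intro mat_col_eqI) auto
    with nz show False by simp
  qed
  then obtain j where j: "j < d'" "col T j \<noteq> 0\<^sub>v d" by blast
  let ?K = "{w \<in> carrier_vec d'. T *\<^sub>v w = 0\<^sub>v d}"
  note K = kernel_invariant_subspace[OF \<sigma>'(1) T \<rho>'(1) comm]
  have "?K \<noteq> carrier_vec d'" using unit[OF j(1)] j by (metis (mono_tags, lifting) mem_Collect_eq unit_vec_carrier)
  hence "?K = {0\<^sub>v d'}" using \<sigma>'(3)[OF K] by blast
  hence inj: "inj_mat T" unfolding inj_mat_def using T by auto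
  let ?I = "(\<lambda>v. T *\<^sub>v v) ` carrier_vec d'"
  note I = image_invariant_subspace[OF \<sigma>'(1) T \<rho>'(1) comm]
  have "col T j \<in> ?I" using unit[OF j(1)] by (metis image_eqI unit_vec_carrier)
  hence surj: "?I = carrier_vec d" using \<rho>'(3)[OF I] j by blast
  have "\<exists>S\<in>carrier_mat d' d. 1\<^sub>m d = T * S"
    using T surj by (intro mat_factor_of_cols[OF one_carrier_mat T]) (auto simp: image_iff set_eq_iff)
  then obtain S where S: "S \<in> carrier_mat d' d" "T * S = 1\<^sub>m d" by auto
  have "T * (S * T) = T * 1\<^sub>m d'"
    using T S by (simp add: assoc_mult_mat[symmetric, of T d d' S d T d'])
  hence "S * T = 1\<^sub>m d'" 
    by (rule inj_mat_cancel[OF inj T mult_carrier_mat[OF S(1) T] one_carrier_mat])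
  with S show ?thesis by blast
qed

text \<open>
  For an eigenvalue \<open>c\<close> of \<open>T\<close>, the intertwiner \<open>T - c\<close> has a nonzero kernel,
  so it is not invertible and must vanish.
\<close>

lemma schur_commutant_scalar:
  assumes \<rho>: "irreducible_representation G d \<rho>"
    and T: "T \<in> carrier_mat d d" and comm: "\<And>g. g \<in> carrier G \<Longrightarrow> \<rho> g * T = T * \<rho> g"
  shows "\<exists>c. T = c \<cdot>\<^sub>m 1\<^sub>m d"
proof -
  note \<rho>' = irreducible_representationD[OF \<rho>]
  from spectrum_non_empty[OF T] \<rho>'(2) obtain c where "eigenvalue T c"
    by (auto simp: spectrum_def)
  then obtain v where v: "v \<in> carrier_vec d" "v \<noteq> 0\<^sub>v d" "T *\<^sub>v v = c \<cdot>\<^sub>v v"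
    using T by (auto simp: eigenvalue_def eigenvector_def)
  let ?D = "T - c \<cdot>\<^sub>m 1\<^sub>m d"
  have D: "?D \<in> carrier_mat d d" by (intro minus_carrier_mat smult_carrier_mat one_carrier_mat)
  have commD: "\<rho> g * ?D = ?D * \<rho> g" if g: "g \<in> carrier G" for g
  proof -
    have r: "\<rho> g \<in> carrier_mat d d" using representation_carrier[OF \<rho>'(1) g] .
    have C: "c \<cdot>\<^sub>m 1\<^sub>m d \<in> carrier_mat d d" by simp
    have "\<rho> g * ?D = \<rho> g * T - \<rho> g * (c \<cdot>\<^sub>m 1\<^sub>m d)" by (rule mult_minus_distrib_mat[OF r T C])
    also have "\<rho> g * (c \<cdot>\<^sub>m 1\<^sub>m d) = (c \<cdot>\<^sub>m 1\<^sub>m d) * \<rho> g"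
      using r mult_smult_distrib[OF r one_carrier_mat] mult_smult_assoc_mat[OF one_carrier_mat r] by simp
    also have "\<rho> g * T - \<dots> = ?D * \<rho> g"
      using comm[OF g] minus_mult_distrib_mat[OF T C r] by simp
    finally show ?thesis .
  qed
  have "?D = 0\<^sub>m d d"
  proof (rule ccontr)
    assume "?D \<noteq> 0\<^sub>m d d"
    from schur_intertwiner_invertible[OF \<rho> \<rho> D commD this] obtain S where
      S: "S \<in> carrier_mat d d" "S * ?D = 1\<^sub>m d" by blast
    have "(c \<cdot>\<^sub>m 1\<^sub>m d) *\<^sub>v v = c \<cdot>\<^sub>v v" using v(1) by (intro eq_vecI) auto
    hence "?D *\<^sub>v v = c \<cdot>\<^sub>v v - c \<cdot>\<^sub>v v"
      using v T minus_mult_distrib_mat_vec[OF T smult_carrier_mat[OF one_carrier_mat] v(1), of c] by simp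
    also have "\<dots> = 0\<^sub>v d" using v(1) by simp
    finally have "S *\<^sub>v (?D *\<^sub>v v) = 0\<^sub>v d" using S(1) by (simp add: mult_mat_vec_def zero_vec_def scalar_prod_def)
    hence "(S * ?D) *\<^sub>v v = 0\<^sub>v d" using assoc_mult_mat_vec[OF S(1) D v(1)] by simp
    with S v show False by simp
  qed
  have "T $$ (i,j) = (c \<cdot>\<^sub>m 1\<^sub>m d) $$ (i,j)" if "i < d" "j < d" for i j
  proof -
    have "?D $$ (i,j) = 0" unfolding \<open>?D = 0\<^sub>m d d\<close> using that by simp
    thus ?thesis using that T by simp
  qed
  thus ?thesis using T by (intro exI[of _ c] eq_matI) auto
qed

lemma bij_betw_mult_right:
  assumes "x \<in> carrier G"
  shows "bij_betw (\<lambda>g. g \<otimes> x) (carrier G) (carrier G)"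
  using assms by (intro bij_betwI[where g = "\<lambda>g. g \<otimes> inv x"]) (auto simp: m_assoc)

text \<open>
  Replacing the summation variable \<open>g\<close> by \<open>g \<otimes> x\<close> moves the action of
  \<open>x\<close> from one side of the average to the other.
\<close>

lemma average_intertwines:
  assumes \<rho>: "representation G d \<rho>" and \<sigma>: "representation G d' \<sigma>"
    and A: "A \<in> carrier_mat d d'" and x: "x \<in> carrier G"
  defines "T \<equiv> sum_mat d d' (carrier G) (\<lambda>g. \<rho> (inv g) * A * \<sigma> g)"
  shows "\<rho> x * T = T * \<sigma> x"
proof -
  note [simp] = representation_carrier[OF \<rho>] representation_carrier[OF \<sigma>]
  have c: "\<rho> (inv g) * A * \<sigma> g \<in> carrier_mat d d'" if "g \<in> carrier G" for g
    using that A by (metis inv_closed mult_carrier_mat representation_carrier \<rho> \<sigma>)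
  have "T * \<sigma> x = sum_mat d d' (carrier G) (\<lambda>g. \<rho> (inv g) * A * \<sigma> g * \<sigma> x)"
    unfolding T_def using c x by (intro sum_mat_mult) auto
  also have "\<dots> = sum_mat d d' (carrier G) (\<lambda>g. (\<lambda>g. \<rho> x * (\<rho> (inv g) * A * \<sigma> g)) (g \<otimes> x))"
  proof (rule sum_mat_cong)
    fix g assume g: "g \<in> carrier G"
    have gx: "inv (g \<otimes> x) \<in> carrier G" using g x by simp
    note Rx = representation_carrier[OF \<rho> x] and R = representation_carrier[OF \<rho> gx]
      and S = representation_carrier[OF \<sigma> g] and Sx = representation_carrier[OF \<sigma> x]
    have "x \<otimes> inv (g \<otimes> x) = inv g" using g x by (simp add: inv_mult_group m_assoc[symmetric])
    hence "\<rho> (inv g) = \<rho> x * \<rho> (inv (g \<otimes> x))"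
      using representation_mult[OF \<rho> x gx] by simp
    hence "\<rho> (inv g) * A * \<sigma> g * \<sigma> x = \<rho> x * (\<rho> (inv (g \<otimes> x)) * A) * \<sigma> g * \<sigma> x"
      using assoc_mult_mat[OF Rx R A] by simp
    also have "\<dots> = \<rho> x * (\<rho> (inv (g \<otimes> x)) * A) * (\<sigma> g * \<sigma> x)"
      by (rule assoc_mult_mat[OF mult_carrier_mat[OF Rx mult_carrier_mat[OF R A]] S Sx])
    also have "\<dots> = \<rho> x * (\<rho> (inv (g \<otimes> x)) * A * (\<sigma> g * \<sigma> x))"
      by (rule assoc_mult_mat[OF Rx mult_carrier_mat[OF R A] mult_carrier_mat[OF S Sx]])
    finally show "\<rho> (inv g) * A * \<sigma> g * \<sigma> x = \<rho> x * (\<rho> (inv (g \<otimes> x)) * A * \<sigma> (g \<otimes> x))"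
      using representation_mult[OF \<sigma> g x] by simp
  qed
  also have "\<dots> = sum_mat d d' (carrier G) (\<lambda>g. \<rho> x * (\<rho> (inv g) * A * \<sigma> g))"
    by (rule sum_mat_reindex[OF bij_betw_mult_right[OF x], of _ _ "\<lambda>g. \<rho> x * (\<rho> (inv g) * A * \<sigma> g)"])
  also have "\<dots> = \<rho> x * T"
    unfolding T_def using c x by (intro mult_sum_mat[symmetric]) auto
  finally show ?thesis ..
qed

lemma entry_average:
  assumes \<rho>: "representation G d \<rho>" and \<sigma>: "representation G d' \<sigma>"
    and "a < d" "b < d'" "i < d" "j < d'"
  shows "sum_mat d d' (carrier G)
      (\<lambda>g. \<rho> (inv g) * mat d d' (\<lambda>(x,y). if x = a \<and> y = b then 1 else 0) * \<sigma> g) $$ (i,j) =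
    (\<Sum>g\<in>carrier G. \<rho> (inv g) $$ (i,a) * \<sigma> g $$ (b,j))"
proof -
  have "(\<rho> (inv g) * mat d d' (\<lambda>(x,y). if x = a \<and> y = b then 1 else 0) * \<sigma> g) $$ (i,j) =
      \<rho> (inv g) $$ (i,a) * \<sigma> g $$ (b,j)" if g: "g \<in> carrier G" for g
    by (rule matrix_unit_sandwich[OF representation_carrier[OF \<rho> inv_closed[OF g]]
          representation_carrier[OF \<sigma> g] assms(3-6)])
  thus ?thesis unfolding sum_mat_index[OF assms(5,6)] by (rule sum.cong[OF refl])
qed

text \<open>
  The average of a matrix unit is an intertwiner between non-isomorphic irreducible representations, hence zero; its
  entries are the sums in question.
\<close>

lemma schur_orthogonality_distinct:
  assumes \<rho>: "irreducible_representation G d \<rho>" and \<sigma>: "irreducible_representation G d' \<sigma>"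
    and noniso: "\<not> isomorphic_representations G d' \<sigma> d \<rho>"
    and ab: "a < d" "b < d'" "i < d" "j < d'"
  shows "(\<Sum>g\<in>carrier G. \<rho> (inv g) $$ (i,a) * \<sigma> g $$ (b,j)) = 0"
proof -
  note R = irreducible_representationD(1)[OF \<rho>] and S = irreducible_representationD(1)[OF \<sigma>]
  define T where "T = sum_mat d d' (carrier G)
    (\<lambda>g. \<rho> (inv g) * mat d d' (\<lambda>(x,y). if x = a \<and> y = b then 1 else 0) * \<sigma> g)"
  have T: "T \<in> carrier_mat d d'" unfolding T_def by simp
  have comm: "\<rho> g * T = T * \<sigma> g" if "g \<in> carrier G" for g
    unfolding T_def by (rule average_intertwines[OF R S mat_carrier that])
  have "T = 0\<^sub>m d d'"
  proof (rule ccontr)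
    assume "T \<noteq> 0\<^sub>m d d'"
    from schur_intertwiner_invertible[OF \<rho> \<sigma> T comm this] obtain U where
      U: "U \<in> carrier_mat d' d" "T * U = 1\<^sub>m d" "U * T = 1\<^sub>m d'" by blast
    have eq: "d' = d" using two_sided_inverse_square[OF T U] by simp
    have "T \<in> Units (cmat_ring d')" unfolding cmat_Units_iff using T U eq by blast
    hence "isomorphic_representations G d' \<sigma> d \<rho>"
      unfolding isomorphic_representations_def using comm eq
      by (intro conjI bexI[of _ T] ballI) auto
    with noniso show False by simp
  qed
  hence "T $$ (i,j) = 0" using ab by simp
  thus ?thesis unfolding T_def entry_average[OF R S ab] .
qed

lemma representation_inv_mult:
  assumes "representation G d \<rho>" "g \<in> carrier G"
  shows "\<rho> g * \<rho> (inv g) = 1\<^sub>m d" "\<rho> (inv g) * \<rho> g = 1\<^sub>m d"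
proof -
  have one: "\<rho> \<one> = 1\<^sub>m d" using assms(1) unfolding representation_iff by blast
  show "\<rho> g * \<rho> (inv g) = 1\<^sub>m d"
    using representation_mult[OF assms(1) assms(2) inv_closed[OF assms(2)]] one assms(2) by simp
  show "\<rho> (inv g) * \<rho> g = 1\<^sub>m d"
    using representation_mult[OF assms(1) inv_closed[OF assms(2)] assms(2)] one assms(2) by simp
qed

text \<open>
  The average of a matrix unit commutes with the representation, hence is a scalar matrix. Its trace determines the
  scalar, since every summand is conjugate to the matrix unit.
\<close>

lemma schur_orthogonality_same:
  assumes \<rho>: "irreducible_representation G d \<rho>"
    and ab: "a < d" "b < d" "i < d" "j < d"
  shows "(\<Sum>g\<in>carrier G. \<rho> (inv g) $$ (i,a) * \<rho> g $$ (b,j)) =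
    (if i = j \<and> a = b then of_nat (order G) / of_nat d else 0)"
proof -
  note R = irreducible_representationD(1,2)[OF \<rho>]
  let ?E = "mat d d (\<lambda>(x,y). if x = a \<and> y = b then 1 else 0) :: complex mat"
  let ?F = "\<lambda>g. \<rho> (inv g) * ?E * \<rho> g"
  let ?T = "sum_mat d d (carrier G) ?F"
  have E: "?E \<in> carrier_mat d d" by simp
  have T: "?T \<in> carrier_mat d d" by simp
  obtain c where c: "?T = c \<cdot>\<^sub>m 1\<^sub>m d"
    using schur_commutant_scalar[OF \<rho> T average_intertwines[OF R(1,1) E]] by blast
  have trE: "mat_trace ?E = (if a = b then 1 else 0)"
  proof -
    have "mat_trace ?E = (\<Sum>x<d. if x = a then (if a = b then 1 else 0) else 0)"
      unfolding mat_trace_def by (auto intro!: sum.cong)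
    thus ?thesis using ab by simp
  qed
  have F: "?F g \<in> carrier_mat d d" "mat_trace (?F g) = mat_trace ?E" if g: "g \<in> carrier G" for g
  proof -
    have ig: "inv g \<in> carrier G" using g by simp
    note A = representation_carrier[OF R(1) g] and B = representation_carrier[OF R(1) ig]
    show "?F g \<in> carrier_mat d d" by (intro mult_carrier_mat[OF mult_carrier_mat[OF B E] A])
    have "mat_trace (?F g) = mat_trace (\<rho> g * (\<rho> (inv g) * ?E))"
      by (rule trace_mult_comm[OF mult_carrier_mat[OF B E] A])
    also have "\<rho> g * (\<rho> (inv g) * ?E) = ?E"
      using assoc_mult_mat[OF A B E] representation_inv_mult(1)[OF R(1) g] by simp
    finally show "mat_trace (?F g) = mat_trace ?E" .
  qed
  have "of_nat d * c = mat_trace (c \<cdot>\<^sub>m 1\<^sub>m d)" by (simp add: mat_trace_def)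
  also have "\<dots> = mat_trace ?T" unfolding c ..
  also have "\<dots> = of_nat (order G) * mat_trace ?E"
    using F by (simp add: mat_trace_sum_mat order_def)
  finally have "c = of_nat (order G) * (if a = b then 1 else 0) / of_nat d"
    using R(2) trE by (simp add: field_simps)
  moreover have "(\<Sum>g\<in>carrier G. \<rho> (inv g) $$ (i,a) * \<rho> g $$ (b,j)) = (c \<cdot>\<^sub>m 1\<^sub>m d) $$ (i,j)"
    using entry_average[OF R(1,1) ab] c by simp
  ultimately show ?thesis using ab by auto
qed

section \<open>Irreducible subrepresentations and the regular representation\<close>

text \<open>
  \<open>\<tau>\<close> is the action of \<open>\<sigma>\<close> on \<open>W\<close> in the coordinates provided by
  the columns of \<open>B\<close>; it is multiplicative because \<open>B\<close> can be cancelled.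
\<close>

lemma invariant_subspace_subrepresentation:
  assumes \<sigma>: "representation G n \<sigma>" and W: "vec_subspace n W"
    and inv: "\<And>g w. g \<in> carrier G \<Longrightarrow> w \<in> W \<Longrightarrow> \<sigma> g *\<^sub>v w \<in> W"
  shows "\<exists>m B \<tau>. B \<in> carrier_mat n m \<and> inj_mat B \<and> W = (\<lambda>v. B *\<^sub>v v) ` carrier_vec m \<and>
    representation G m \<tau> \<and> (\<forall>g\<in>carrier G. \<sigma> g * B = B * \<tau> g)"
proof -
  obtain m B where B: "B \<in> carrier_mat n m" "inj_mat B" and WB: "W = (\<lambda>v. B *\<^sub>v v) ` carrier_vec m"
    using subspace_basis_mat[OF W] by blast
  have "\<exists>C\<in>carrier_mat m m. \<sigma> g * B = B * C" if g: "g \<in> carrier G" for g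
  proof (rule mat_factor_of_cols[OF mult_carrier_mat[OF representation_carrier[OF \<sigma> g] B(1)] B(1)])
    fix j assume j: "j < m"
    have "col B j = B *\<^sub>v unit_vec m j" using B(1) j by (intro eq_vecI) auto
    hence "col B j \<in> W" unfolding WB by (metis image_eqI unit_vec_carrier)
    hence "\<sigma> g *\<^sub>v col B j \<in> W" by (rule inv[OF g])
    moreover have "col (\<sigma> g * B) j = \<sigma> g *\<^sub>v col B j"
      by (rule col_mult2[OF representation_carrier[OF \<sigma> g] B(1) j])
    ultimately show "\<exists>v\<in>carrier_vec m. col (\<sigma> g * B) j = B *\<^sub>v v" unfolding WB by auto
  qed
  then obtain \<tau> where \<tau>: "\<And>g. g \<in> carrier G \<Longrightarrow> \<tau> g \<in> carrier_mat m m"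
    "\<And>g. g \<in> carrier G \<Longrightarrow> \<sigma> g * B = B * \<tau> g" by metis
  have "representation G m \<tau>" unfolding representation_iff
  proof (intro conjI ballI)
    have "B * \<tau> \<one> = B * 1\<^sub>m m"
      using \<tau>(2)[OF one_closed] \<sigma> B(1) by (simp add: representation_iff)
    thus "\<tau> \<one> = 1\<^sub>m m" by (rule inj_mat_cancel[OF B(2,1) \<tau>(1)[OF one_closed] one_carrier_mat])
    fix g h assume g: "g \<in> carrier G" and h: "h \<in> carrier G"
    have gh: "g \<otimes> h \<in> carrier G" using g h by simp
    note Sg = representation_carrier[OF \<sigma> g] and Sh = representation_carrier[OF \<sigma> h]
    have "B * \<tau> (g \<otimes> h) = \<sigma> g * \<sigma> h * B" using \<tau>(2)[OF gh] representation_mult[OF \<sigma> g h] by simp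
    also have "\<dots> = \<sigma> g * (B * \<tau> h)" using assoc_mult_mat[OF Sg Sh B(1)] \<tau>(2)[OF h] by simp
    also have "\<dots> = B * \<tau> g * \<tau> h" using assoc_mult_mat[OF Sg B(1) \<tau>(1)[OF h]] \<tau>(2)[OF g] by simp
    also have "\<dots> = B * (\<tau> g * \<tau> h)" by (rule assoc_mult_mat[OF B(1) \<tau>(1)[OF g] \<tau>(1)[OF h]])
    finally show "\<tau> (g \<otimes> h) = \<tau> g * \<tau> h"
      by (rule inj_mat_cancel[OF B(2,1) \<tau>(1)[OF gh] mult_carrier_mat[OF \<tau>(1)[OF g] \<tau>(1)[OF h]]])
  qed (use \<tau> in auto)
  with B WB \<tau>(2) show ?thesis by blast
qed

text \<open>
  A nonzero invariant subspace of \<open>U\<close> of least dimension is irreducible. It is encoded by an injective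
  matrix \<open>B\<close>, and a smaller invariant subspace would give a product \<open>B * C\<close> with fewer
  columns.
\<close>

lemma irreducible_subrepresentation:
  assumes \<sigma>: "representation G n \<sigma>" and U: "vec_subspace n U" and U0: "U \<noteq> {0\<^sub>v n}"
    and inv: "\<And>g w. g \<in> carrier G \<Longrightarrow> w \<in> U \<Longrightarrow> \<sigma> g *\<^sub>v w \<in> U"
  shows "\<exists>m B \<tau>. B \<in> carrier_mat n m \<and> inj_mat B \<and> (\<forall>v\<in>carrier_vec m. B *\<^sub>v v \<in> U) \<and>
    irreducible_representation G m \<tau> \<and> (\<forall>g\<in>carrier G. \<sigma> g * B = B * \<tau> g)"
proof -
  let ?P = "\<lambda>m B \<tau>. m > 0 \<and> B \<in> carrier_mat n m \<and> inj_mat B \<and> (\<forall>v\<in>carrier_vec m. B *\<^sub>v v \<in> U) \<and>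
    representation G m \<tau> \<and> (\<forall>g\<in>carrier G. \<sigma> g * B = B * \<tau> g)"
  have zero: "B *\<^sub>v v = 0\<^sub>v n" if "B \<in> carrier_mat n 0" "v \<in> carrier_vec 0"
    for B :: "complex mat" and v and n
    using that by (intro eq_vecI) (auto simp: scalar_prod_def)
  have pos: "m > 0" if "W = (\<lambda>v. B *\<^sub>v v) ` carrier_vec m" "B \<in> carrier_mat n m" "vec_subspace n W" "W \<noteq> {0\<^sub>v n}"
    for W and B :: "complex mat" and m n
  proof (rule ccontr)
    assume "\<not> m > 0"
    hence "W \<subseteq> {0\<^sub>v n}" using that zero[of B n] by auto
    moreover have "0\<^sub>v n \<in> W" using that(3) unfolding vec_subspace_iff by blast
    ultimately show False using that(4) by blast
  qed
  obtain m1 B1 \<tau>1 where 1: "B1 \<in> carrier_mat n m1" "inj_mat B1" "U = (\<lambda>v. B1 *\<^sub>v v) ` carrier_vec m1"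
    "representation G m1 \<tau>1" "\<forall>g\<in>carrier G. \<sigma> g * B1 = B1 * \<tau>1 g"
    using invariant_subspace_subrepresentation[OF \<sigma> U inv] by blast
  have "?P m1 B1 \<tau>1" using 1 pos[OF 1(3,1) U U0] by auto
  hence "\<exists>m B \<tau>. ?P m B \<tau>" by blast
  define m where "m = (LEAST m. \<exists>B \<tau>. ?P m B \<tau>)"
  have "\<exists>B \<tau>. ?P m B \<tau>"
    unfolding m_def by (rule LeastI_ex[of "\<lambda>m. \<exists>B \<tau>. ?P m B \<tau>"]) fact
  have least: "m \<le> m'" if "\<exists>B \<tau>. ?P m' B \<tau>" for m'
    unfolding m_def using that by (rule Least_le[of "\<lambda>m. \<exists>B \<tau>. ?P m B \<tau>"])
  from \<open>\<exists>B \<tau>. ?P m B \<tau>\<close> obtain B \<tau> where B: "m > 0" "B \<in> carrier_mat n m" "inj_mat B" "\<forall>v\<in>carrier_vec m. B *\<^sub>v v \<in> U"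
    "representation G m \<tau>" "\<forall>g\<in>carrier G. \<sigma> g * B = B * \<tau> g" by blast
  have "W = {0\<^sub>v m} \<or> W = carrier_vec m"
    if W: "vec_subspace m W" and invW: "\<And>g w. g \<in> carrier G \<Longrightarrow> w \<in> W \<Longrightarrow> \<tau> g *\<^sub>v w \<in> W" for W
  proof (rule ccontr)
    assume neg: "\<not> ?thesis"
    obtain k C \<tau>' where C: "C \<in> carrier_mat m k" "inj_mat C" "W = (\<lambda>v. C *\<^sub>v v) ` carrier_vec k"
      "representation G k \<tau>'" "\<forall>g\<in>carrier G. \<tau> g * C = C * \<tau>' g"
      using invariant_subspace_subrepresentation[OF B(5) W invW] by blast
    have "k > 0" using pos[OF C(3,1) W] neg by blast
    have "k \<noteq> m"
    proof
      assume "k = m"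
      hence "carrier_vec m \<subseteq> W" using inj_mat_square_surj[OF C(2)] C(1,3) by blast
      moreover have "W \<subseteq> carrier_vec m" using W unfolding vec_subspace_iff by blast
      ultimately show False using neg by blast
    qed
    hence "k < m" using inj_mat_dim_le[OF C(2,1)] by simp
    have BC: "B * C \<in> carrier_mat n k" using B C by simp
    have "inj_mat (B * C)" unfolding inj_mat_def
    proof (intro ballI impI)
      fix v assume "v \<in> carrier_vec (dim_col (B * C))" and z: "(B * C) *\<^sub>v v = 0\<^sub>v (dim_row (B * C))"
      hence v: "v \<in> carrier_vec k" using C(1) by simp
      have "B *\<^sub>v (C *\<^sub>v v) = 0\<^sub>v n" using z assoc_mult_mat_vec[OF B(2) C(1) v] B(2) by simp
      hence "C *\<^sub>v v = 0\<^sub>v m" by (rule inj_matD[OF B(3,2) mult_mat_vec_carrier[OF C(1) v]])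
      hence "v = 0\<^sub>v k" by (rule inj_matD[OF C(2,1) v])
      thus "v = 0\<^sub>v (dim_col (B * C))" using C by simp
    qed
    moreover have "(B * C) *\<^sub>v v \<in> U" if v: "v \<in> carrier_vec k" for v
      using assoc_mult_mat_vec[OF B(2) C(1) v] B(4) mult_mat_vec_carrier[OF C(1) v] by simp
    moreover have "\<sigma> g * (B * C) = B * C * \<tau>' g" if g: "g \<in> carrier G" for g
    proof -
      note Sg = representation_carrier[OF \<sigma> g] and Tg = representation_carrier[OF B(5) g]
        and Tg' = representation_carrier[OF C(4) g]
      have "\<sigma> g * (B * C) = B * \<tau> g * C" using assoc_mult_mat[OF Sg B(2) C(1)] B(6) g by simp
      also have "\<dots> = B * (C * \<tau>' g)" using assoc_mult_mat[OF B(2) Tg C(1)] C(5) g by simp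
      also have "\<dots> = B * C * \<tau>' g" using assoc_mult_mat[OF B(2) C(1) Tg'] by simp
      finally show ?thesis .
    qed
    ultimately have "?P k (B * C) \<tau>'" using \<open>k > 0\<close> BC C(4) by blast
    hence "m \<le> k" using least by blast
    thus False using \<open>k < m\<close> by simp
  qed
  hence "irreducible_representation G m \<tau>"
    unfolding irreducible_representation_def using B by blast
  with B show ?thesis by blast
qed

text \<open>
  The bijection \<open>e\<close> numbers the group elements, so that a vector \<open>v\<close> stands for the function
  that takes the value \<open>v $ x\<close> at \<open>e x\<close>; the matrix \<open>R g\<close> is then the right
  translation taking a function \<open>f\<close> to \<open>\<lambda>x. f (x \<otimes> g)\<close>.
\<close>

lemma right_regular_representation:
  assumes e: "bij_betw e {..<n} (carrier G)"
  defines "R \<equiv> \<lambda>g. mat n n (\<lambda>(x,y). if e x \<otimes> g = e y then 1 else 0) :: complex mat"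
  shows "representation G n R"
    and "\<And>g v x y. g \<in> carrier G \<Longrightarrow> v \<in> carrier_vec n \<Longrightarrow> x < n \<Longrightarrow> y < n \<Longrightarrow> e x \<otimes> g = e y \<Longrightarrow>
      (R g *\<^sub>v v) $ x = v $ y"
proof -
  have inj: "e x = e y \<longleftrightarrow> x = y" if "x < n" "y < n" for x y
    using e that unfolding bij_betw_def inj_on_def by auto
  have eG: "e x \<in> carrier G" if "x < n" for x using e that unfolding bij_betw_def by auto
  have surj: "\<exists>y<n. e y = g" if "g \<in> carrier G" for g
    using e that unfolding bij_betw_def by (metis imageE lessThan_iff)
  have R: "R g \<in> carrier_mat n n" for g unfolding R_def by simp
  have entry: "R g $$ (x, z) = (if z = y then 1 else 0)"
    if "x < n" "y < n" "z < n" "e x \<otimes> g = e y" for g x y z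
    using that inj by (auto simp: R_def)
  show "(R g *\<^sub>v v) $ x = v $ y"
    if g: "g \<in> carrier G" and v: "v \<in> carrier_vec n" and x: "x < n" and y: "y < n"
      and xy: "e x \<otimes> g = e y" for g v x y
  proof -
    have "(R g *\<^sub>v v) $ x = (\<Sum>z<n. R g $$ (x,z) * v $ z)"
      using R[of g] v x by (auto simp: scalar_prod_def atLeast0LessThan intro!: sum.cong)
    also have "\<dots> = (\<Sum>z<n. if z = y then v $ z else 0)"
      using entry[OF x y _ xy] by (intro sum.cong) auto
    finally show ?thesis using y by simp
  qed
  show "representation G n R" unfolding representation_iff
  proof (intro conjI ballI)
    show "R \<one> = 1\<^sub>m n" using inj eG by (intro eq_matI) (auto simp: R_def)
    fix g h assume g: "g \<in> carrier G" and h: "h \<in> carrier G"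
    show "R (g \<otimes> h) = R g * R h"
    proof (rule eq_matI)
      fix x z assume "x < dim_row (R g * R h)" "z < dim_col (R g * R h)"
      hence xz: "x < n" "z < n" using R by (metis carrier_matD index_mult_mat(2,3))+
      obtain y where y: "y < n" "e y = e x \<otimes> g" using surj[of "e x \<otimes> g"] eG xz g by auto
      have "(R g * R h) $$ (x,z) = (\<Sum>w<n. R g $$ (x,w) * R h $$ (w,z))"
        using R[of g] R[of h] xz by (auto simp: scalar_prod_def atLeast0LessThan intro!: sum.cong)
      also have "\<dots> = (\<Sum>w<n. if w = y then R h $$ (w,z) else 0)"
        using entry[OF xz(1) y(1) _ y(2)[symmetric]] by (intro sum.cong) auto
      also have "\<dots> = R h $$ (y,z)" using y by simp
      also have "\<dots> = R (g \<otimes> h) $$ (x,z)"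
        using xz y eG g h by (simp add: R_def m_assoc)
      finally show "R (g \<otimes> h) $$ (x,z) = (R g * R h) $$ (x,z)" ..
    qed (auto simp: R_def)
  qed (use R in auto)
qed

section \<open>Completeness of the irreducible representations and Fourier inversion\<close>

lemma irreducible_representativesD:
  assumes "irreducible_representatives G r d \<rho>"
  shows "i \<in> {1..r} \<Longrightarrow> irreducible_representation G (d i) (\<rho> i)"
    and "irreducible_representation G m \<sigma> \<Longrightarrow>
      \<exists>!i. i \<in> {1..r} \<and> isomorphic_representations G (d i) (\<rho> i) m \<sigma>"
  using assms unfolding irreducible_representatives_def by blast+

lemma isomorphic_representations_refl:
  assumes "representation G d \<rho>"
  shows "isomorphic_representations G d \<rho> d \<rho>"
proof -
  have "1\<^sub>m d \<in> Units (cmat_ring d)"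
    unfolding cmat_Units_iff by (intro conjI bexI[of _ "1\<^sub>m d"]) auto
  moreover have "1\<^sub>m d * \<rho> g = \<rho> g * 1\<^sub>m d" if "g \<in> carrier G" for g
    using representation_carrier[OF assms that] by simp
  ultimately show ?thesis unfolding isomorphic_representations_def by blast
qed

lemma representatives_not_isomorphic:
  assumes IR: "irreducible_representatives G r d \<rho>" and "i \<in> {1..r}" "j \<in> {1..r}" "i \<noteq> j"
  shows "\<not> isomorphic_representations G (d i) (\<rho> i) (d j) (\<rho> j)"
proof
  assume iso: "isomorphic_representations G (d i) (\<rho> i) (d j) (\<rho> j)"
  have irr: "irreducible_representation G (d j) (\<rho> j)"
    by (rule irreducible_representativesD(1)[OF IR assms(3)])
  have "isomorphic_representations G (d j) (\<rho> j) (d j) (\<rho> j)"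
    by (rule isomorphic_representations_refl[OF irreducible_representationD(1)[OF irr]])
  with iso irreducible_representativesD(2)[OF IR irr] assms(2-4) show False by blast
qed

text \<open>
  Let \<open>K\<close> consist of the functions whose complex conjugate has vanishing transform. It is invariant under
  right translation, so if nonzero it contains an irreducible subrepresentation \<open>\<tau>\<close>, with basis
  given by the columns of \<open>B\<close>, and \<open>\<tau>\<close> is isomorphic to some \<open>\<rho> i\<close>.
  For a basis function \<open>v\<close>, its value at \<open>g\<close> is the value at the identity of its translate
  by \<open>g\<close>; hence \<open>v\<close> is a combination of coefficients of \<open>\<tau>\<close>, and so of
  \<open>\<rho> i\<close>. But \<open>v \<in> K\<close> is orthogonal to these coefficients, therefore to itself.
\<close>

lemma fourier_injective:
  fixes f :: "'a \<Rightarrow> complex"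
  assumes fin: "finite (carrier G)" and IR: "irreducible_representatives G r d \<rho>"
    and zero: "\<And>i a b. i \<in> {1..r} \<Longrightarrow> a < d i \<Longrightarrow> b < d i \<Longrightarrow>
      (\<Sum>g\<in>carrier G. f g * \<rho> i g $$ (a,b)) = 0"
    and g: "g \<in> carrier G"
  shows "f g = 0"
proof (rule ccontr)
  assume nz: "f g \<noteq> 0"
  define n where "n = card (carrier G)"
  obtain e where e: "bij_betw e {..<n} (carrier G)"
    using ex_bij_betw_nat_finite[OF fin] unfolding n_def atLeast0LessThan by blast
  have eG: "e x \<in> carrier G" if "x < n" for x using e that unfolding bij_betw_def by auto
  have surj: "\<exists>y<n. e y = g" if "g \<in> carrier G" for g
    using e that unfolding bij_betw_def by (metis imageE lessThan_iff)
  define R :: "'a \<Rightarrow> complex mat" where "R = (\<lambda>g. mat n n (\<lambda>(x,y). if e x \<otimes> g = e y then 1 else 0))"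
  have R: "representation G n R"
    unfolding R_def by (rule right_regular_representation(1)[OF e])
  have shift: "(R g *\<^sub>v v) $ x = v $ y"
    if "g \<in> carrier G" "v \<in> carrier_vec n" "x < n" "y < n" "e x \<otimes> g = e y" for g v x y
    unfolding R_def by (rule right_regular_representation(2)[OF e that])
  define K where "K = {v \<in> carrier_vec n. \<forall>i\<in>{1..r}. \<forall>a<d i. \<forall>b<d i.
    (\<Sum>x<n. cnj (v $ x) * \<rho> i (e x) $$ (a,b)) = 0}"
  have rep: "representation G (d i) (\<rho> i)" if "i \<in> {1..r}" for i
    using irreducible_representationD(1)[OF irreducible_representativesD(1)[OF IR that]] .
  have K: "vec_subspace n K"
    unfolding vec_subspace_iff
  proof (intro conjI ballI allI)
    show "v + w \<in> K" if "v \<in> K" "w \<in> K" for v w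
      using that unfolding K_def by (auto simp: distrib_right sum.distrib)
    show "c \<cdot>\<^sub>v v \<in> K" if "v \<in> K" for c v
      using that unfolding K_def by (auto simp: mult.assoc sum_distrib_left[symmetric])
  qed (auto simp: K_def)
  have Kinv: "R h *\<^sub>v v \<in> K" if h: "h \<in> carrier G" and v: "v \<in> K" for h v
  proof -
    have vc: "v \<in> carrier_vec n" using v unfolding K_def by auto
    \<comment> \<open>Right translation by \<open>h\<close> as a permutation of the indices.\<close>
    define \<pi> where "\<pi> = (\<lambda>x. inv_into {..<n} e (e x \<otimes> h))"
    have \<pi>e: "e (\<pi> x) = e x \<otimes> h" "\<pi> x < n" if "x < n" for x
    proof -
      have "e x \<otimes> h \<in> e ` {..<n}" using e eG[OF that] h by (simp add: bij_betw_def)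
      thus "e (\<pi> x) = e x \<otimes> h" "\<pi> x < n" unfolding \<pi>_def
        by (simp_all add: f_inv_into_f) (metis inv_into_into lessThan_iff)
    qed
    have "bij_betw (inv_into {..<n} e \<circ> (\<lambda>g. g \<otimes> h) \<circ> e) {..<n} {..<n}"
      by (intro bij_betw_trans[OF e] bij_betw_trans[OF bij_betw_mult_right[OF h]] bij_betw_inv_into[OF e])
    hence \<pi>: "bij_betw \<pi> {..<n} {..<n}" unfolding \<pi>_def comp_def .
    have "(\<Sum>x<n. cnj ((R h *\<^sub>v v) $ x) * \<rho> i (e x) $$ (a,b)) = 0"
      if i: "i \<in> {1..r}" and ab: "a < d i" "b < d i" for i a b
    proof -
      have ih: "inv h \<in> carrier G" using h by simp
      \<comment> \<open>The identity factor brings the product into the form \<open>M * F x * N\<close> of \<open>weighted_sum_sandwich_zero\<close>.\<close>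
      have *: "\<rho> i (e x) = 1\<^sub>m (d i) * \<rho> i (e (\<pi> x)) * \<rho> i (inv h)" if x: "x < n" for x
      proof -
        have "e (\<pi> x) \<otimes> inv h = e x" using \<pi>e[OF x] eG[OF x] h by (simp add: m_assoc)
        thus ?thesis
          using representation_mult[OF rep[OF i] eG[OF \<pi>e(2)[OF x]] ih]
            representation_carrier[OF rep[OF i] eG[OF \<pi>e(2)[OF x]]] by simp
      qed
      have "(\<Sum>x<n. cnj ((R h *\<^sub>v v) $ x) * \<rho> i (e x) $$ (a,b)) =
          (\<Sum>x<n. cnj (v $ \<pi> x) * (1\<^sub>m (d i) * \<rho> i (e (\<pi> x)) * \<rho> i (inv h)) $$ (a,b))"
      proof (rule sum.cong[OF refl])
        fix x assume "x \<in> {..<n}"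
        hence x: "x < n" by simp
        have "(R h *\<^sub>v v) $ x = v $ \<pi> x"
          by (rule shift[OF h vc x \<pi>e(2)[OF x] \<pi>e(1)[OF x, symmetric]])
        thus "cnj ((R h *\<^sub>v v) $ x) * \<rho> i (e x) $$ (a,b) =
            cnj (v $ \<pi> x) * (1\<^sub>m (d i) * \<rho> i (e (\<pi> x)) * \<rho> i (inv h)) $$ (a,b)"
          by (simp only: *[OF x])
      qed
      also have "\<dots> = (\<Sum>y<n. cnj (v $ y) * (1\<^sub>m (d i) * \<rho> i (e y) * \<rho> i (inv h)) $$ (a,b))"
        by (rule sum.reindex_bij_betw[OF \<pi>])
      also have "\<dots> = 0"
      proof (rule weighted_sum_sandwich_zero[OF one_carrier_mat representation_carrier[OF rep[OF i] ih]])
        show "\<rho> i (e x) \<in> carrier_mat (d i) (d i)" if "x \<in> {..<n}" for x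
          using that by (intro representation_carrier[OF rep[OF i]] eG) auto
        show "(\<Sum>x<n. cnj (v $ x) * \<rho> i (e x) $$ (a, b)) = 0" if "a < d i" "b < d i" for a b
          using v that i unfolding K_def by blast
      qed (use ab in auto)
      finally show ?thesis .
    qed
    thus ?thesis unfolding K_def using mult_mat_vec_carrier[OF representation_carrier[OF R h] vc] by blast
  qed
  have "K \<noteq> {0\<^sub>v n}"
  proof
    assume K0: "K = {0\<^sub>v n}"
    have "vec n (\<lambda>x. cnj (f (e x))) \<in> K"
    proof -
      have "(\<Sum>x<n. f (e x) * \<rho> i (e x) $$ (a,b)) = 0" if "i \<in> {1..r}" "a < d i" "b < d i" for i a b
        using zero[OF that] sum.reindex_bij_betw[OF e, of "\<lambda>g. f g * \<rho> i g $$ (a,b)"] by simp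
      thus ?thesis unfolding K_def by simp
    qed
    moreover obtain x where x: "x < n" "e x = g" using surj[OF g] by blast
    ultimately have "vec n (\<lambda>x. cnj (f (e x))) $ x = 0" using K0 by simp
    thus False using x nz by simp
  qed
  from irreducible_subrepresentation[OF R K this Kinv] obtain m B \<tau> where
    B: "B \<in> carrier_mat n m" "inj_mat B" "\<forall>v\<in>carrier_vec m. B *\<^sub>v v \<in> K" and
    \<tau>: "irreducible_representation G m \<tau>" and RB: "\<forall>g\<in>carrier G. R g * B = B * \<tau> g" by blast
  note \<tau>' = irreducible_representationD(1,2)[OF \<tau>]
  obtain i where i: "i \<in> {1..r}" and iso: "isomorphic_representations G (d i) (\<rho> i) m \<tau>"
    using irreducible_representativesD(2)[OF IR \<tau>] by blast
  have dm: "d i = m" using iso unfolding isomorphic_representations_def by blast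
  obtain T where TU: "T \<in> Units (cmat_ring m)"
    and comm: "\<And>g. g \<in> carrier G \<Longrightarrow> T * \<rho> i g = \<tau> g * T"
    using iso unfolding isomorphic_representations_def dm by blast
  obtain S where T: "T \<in> carrier_mat m m" "S \<in> carrier_mat m m" "T * S = 1\<^sub>m m"
    using TU unfolding cmat_Units_iff by blast
  obtain x0 where x0: "x0 < n" "e x0 = \<one>" using surj[OF one_closed] by blast
  define v where "v = B *\<^sub>v unit_vec m 0"
  have v: "v \<in> carrier_vec n" "v \<in> K" using B unfolding v_def by auto
  have unit: "(A *\<^sub>v unit_vec m 0) $ x = A $$ (x, 0)" if "A \<in> carrier_mat n m" "x < n"
    for A :: "complex mat" and x
    using that \<tau>'(2) by simp
  have coeff: "v $ x = (B * T * \<rho> i (e x) * S) $$ (x0, 0)" if x: "x < n" for x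
  proof -
    note ex = eG[OF x]
    note Rx = representation_carrier[OF R ex] and Tx = representation_carrier[OF \<tau>'(1) ex]
      and Px = representation_carrier[OF rep[OF i] ex, unfolded dm]
    \<comment> \<open>The value of \<open>v\<close> at \<open>e x\<close> is the value of its translate at the identity, which has index \<open>x0\<close>.\<close>
    have "v $ x = (R (e x) *\<^sub>v v) $ x0" using shift[OF ex v(1) x0(1) x] x0(2) ex by simp
    also have "R (e x) *\<^sub>v v = (R (e x) * B) *\<^sub>v unit_vec m 0"
      unfolding v_def by (rule assoc_mult_mat_vec[OF Rx B(1) unit_vec_carrier, symmetric])
    also have "\<dots> $ x0 = (R (e x) * B) $$ (x0, 0)"
      by (rule unit[OF mult_carrier_mat[OF Rx B(1)] x0(1)])
    also have "R (e x) * B = B * \<tau> (e x)" using RB ex by blast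
    also have "\<tau> (e x) = \<tau> (e x) * (T * S)" using Tx T(3) by simp
    also have "\<dots> = T * \<rho> i (e x) * S" using assoc_mult_mat[OF Tx T(1,2)] comm[OF ex] by simp
    also have "B * \<dots> = B * T * \<rho> i (e x) * S"
      using assoc_mult_mat[OF B(1) mult_carrier_mat[OF T(1) Px] T(2)] assoc_mult_mat[OF B(1) T(1) Px] by simp
    finally show ?thesis .
  qed
  \<comment> \<open>Rewriting only the second factor exhibits the squared norm as a combination of sums that vanish on \<open>K\<close>.\<close>
  have "(\<Sum>x<n. cnj (v $ x) * v $ x) = (\<Sum>x<n. cnj (v $ x) * (B * T * \<rho> i (e x) * S) $$ (x0, 0))"
    using coeff by (intro sum.cong) auto
  also have "\<dots> = 0"
  proof (rule weighted_sum_sandwich_zero[OF mult_carrier_mat[OF B(1) T(1)] T(2)])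
    show "\<rho> i (e x) \<in> carrier_mat m m" if "x \<in> {..<n}" for x
      using representation_carrier[OF rep[OF i] eG[of x]] that dm by simp
    show "(\<Sum>x<n. cnj (v $ x) * \<rho> i (e x) $$ (a, b)) = 0" if "a < m" "b < m" for a b
      using v(2) that i dm unfolding K_def by blast
  qed (use x0 \<tau>'(2) in auto)
  finally have "(\<Sum>x<n. of_real ((cmod (v $ x))\<^sup>2) :: complex) = 0"
    by (simp add: complex_norm_square mult.commute del: of_real_power)
  hence "(\<Sum>x<n. (cmod (v $ x))\<^sup>2) = 0" by (metis of_real_sum of_real_eq_0_iff)
  hence "v $ x = 0" if "x < n" for x using that by (subst (asm) sum_nonneg_eq_0_iff) auto
  hence "v = 0\<^sub>v n" using v(1) by (intro eq_vecI) auto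
  hence "unit_vec m 0 = (0\<^sub>v m :: complex vec)"
    unfolding v_def by (intro inj_matD[OF B(2,1)]) auto
  hence "unit_vec m 0 $ 0 = (0\<^sub>v m $ 0 :: complex)" by simp
  thus False using \<tau>'(2) by simp
qed

text \<open>
  This is the character of the regular representation, evaluated without decomposing it: by the orthogonality
  relations both sides have the transform \<open>order G \<cdot> I\<close> at every \<open>\<rho> j\<close>, and
  functions are determined by their transforms.
\<close>

lemma regular_character:
  assumes fin: "finite (carrier G)" and IR: "irreducible_representatives G r d \<rho>"
    and g: "g \<in> carrier G"
  shows "(\<Sum>i=1..r. of_nat (d i) * mat_trace (\<rho> i (inv g))) = (if g = \<one> then of_nat (order G) else 0)"
proof -
  let ?u = "\<lambda>g. \<Sum>i=1..r. of_nat (d i) * mat_trace (\<rho> i (inv g))"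
  let ?\<delta> = "\<lambda>g. if g = \<one> then of_nat (order G) else 0 :: complex"
  note irr = irreducible_representativesD(1)[OF IR]
  note rep = irreducible_representationD(1)[OF irr] and dpos = irreducible_representationD(2)[OF irr]
  have "?u g - ?\<delta> g = 0"
  proof (rule fourier_injective[OF fin IR _ g, where f = "\<lambda>g. ?u g - ?\<delta> g"])
    fix j b l assume j: "j \<in> {1..r}" and bl: "b < d j" "l < d j"
    have trace_sum: "(\<Sum>g\<in>carrier G. mat_trace (\<rho> i (inv g)) * \<rho> j g $$ (b,l)) =
        (if i = j \<and> b = l then of_nat (order G) / of_nat (d j) else 0)" if i: "i \<in> {1..r}" for i
    proof -
      have "(\<Sum>g\<in>carrier G. mat_trace (\<rho> i (inv g)) * \<rho> j g $$ (b,l)) =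
          (\<Sum>g\<in>carrier G. \<Sum>a<d i. \<rho> i (inv g) $$ (a,a) * \<rho> j g $$ (b,l))"
      proof (rule sum.cong[OF refl])
        fix g assume "g \<in> carrier G"
        hence "dim_row (\<rho> i (inv g)) = d i" using representation_carrier[OF rep[OF i]] by blast
        thus "mat_trace (\<rho> i (inv g)) * \<rho> j g $$ (b,l) = (\<Sum>a<d i. \<rho> i (inv g) $$ (a,a) * \<rho> j g $$ (b,l))"
          by (simp add: mat_trace_def sum_distrib_right)
      qed
      also have "\<dots> = (\<Sum>a<d i. \<Sum>g\<in>carrier G. \<rho> i (inv g) $$ (a,a) * \<rho> j g $$ (b,l))"
        by (rule sum.swap)
      also have "\<dots> = (\<Sum>a<d i. if i = j then if a = b then if b = l then of_nat (order G) / of_nat (d j) else 0 else 0 else 0)"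
      proof (rule sum.cong[OF refl])
        fix a assume "a \<in> {..<d i}"
        hence a: "a < d i" by simp
        show "(\<Sum>g\<in>carrier G. \<rho> i (inv g) $$ (a,a) * \<rho> j g $$ (b,l)) =
          (if i = j then if a = b then if b = l then of_nat (order G) / of_nat (d j) else 0 else 0 else 0)"
        proof (cases "i = j")
          case True
          show ?thesis using schur_orthogonality_same[OF irr[OF j], of a b a l] a bl True by auto
        next
          case False
          show ?thesis
            using schur_orthogonality_distinct[OF irr[OF i] irr[OF j]
                representatives_not_isomorphic[OF IR j i] a bl(1) a bl(2)] False by simp
        qed
      qed
      also have "\<dots> = (if i = j \<and> b = l then of_nat (order G) / of_nat (d j) else 0)"
        using bl by auto
      finally show ?thesis .
    qed
    have "(\<Sum>g\<in>carrier G. ?u g * \<rho> j g $$ (b,l)) =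
        (\<Sum>g\<in>carrier G. \<Sum>i=1..r. of_nat (d i) * (mat_trace (\<rho> i (inv g)) * \<rho> j g $$ (b,l)))"
      by (simp add: sum_distrib_right mult.assoc)
    also have "\<dots> = (\<Sum>i=1..r. of_nat (d i) * (\<Sum>g\<in>carrier G. mat_trace (\<rho> i (inv g)) * \<rho> j g $$ (b,l)))"
      by (subst sum.swap) (simp add: sum_distrib_left)
    also have "\<dots> = (\<Sum>i=1..r. if i = j then if b = l then of_nat (order G) else 0 else 0)"
      using dpos[OF j] by (intro sum.cong refl) (auto simp: trace_sum)
    also have "\<dots> = (if b = l then of_nat (order G) else 0)" using j by simp
    finally have u: "(\<Sum>g\<in>carrier G. ?u g * \<rho> j g $$ (b,l)) = (if b = l then of_nat (order G) else 0)" .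
    have "\<rho> j \<one> = 1\<^sub>m (d j)" using rep[OF j] unfolding representation_iff by blast
    hence "(\<Sum>g\<in>carrier G. ?\<delta> g * \<rho> j g $$ (b,l)) = (if b = l then of_nat (order G) else 0)"
      using fin bl by (simp add: if_distrib[of "\<lambda>x. x * _"] cong: if_cong)
    with u show "(\<Sum>g\<in>carrier G. (?u g - ?\<delta> g) * \<rho> j g $$ (b,l)) = 0"
      by (simp add: left_diff_distrib sum_subtractf)
  qed
  thus ?thesis by simp
qed

lemma fourier_eq_sum_mat:
  assumes fin: "finite (carrier G)" and \<rho>: "representation G d \<rho>"
  shows "fourier G f d \<rho> = sum_mat d d (carrier G) (\<lambda>g. complex_of_real (f g) \<cdot>\<^sub>m \<rho> g)"
proof -
  interpret R: ring "cmat_ring d" by (rule ring_mat)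
  let ?F = "\<lambda>g. complex_of_real (f g) \<cdot>\<^sub>m \<rho> g"
  have F: "?F g \<in> carrier_mat d d" if "g \<in> carrier G" for g
    using representation_carrier[OF \<rho> that] by simp
  have "(\<Oplus>\<^bsub>cmat_ring d\<^esub>g\<in>A. ?F g) = sum_mat d d A ?F" if "finite A" "A \<subseteq> carrier G" for A
    using that
  proof induction
    case empty
    show ?case by (intro eq_matI) (auto simp: ring_mat_simps)
  next
    case (insert x A)
    hence "(\<Oplus>\<^bsub>cmat_ring d\<^esub>g\<in>insert x A. ?F g) = ?F x + sum_mat d d A ?F"
      using F by (subst R.finsum_insert) (auto simp: ring_mat_simps)
    also have "\<dots> = sum_mat d d (insert x A) ?F"
      using insert F[of x] by (intro eq_matI) auto
    finally show ?case .
  qed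
  thus ?thesis unfolding fourier_def using fin by blast
qed

lemma fourier_carrier:
  assumes "finite (carrier G)" "representation G d \<rho>"
  shows "fourier G f d \<rho> \<in> carrier_mat d d"
  using fourier_eq_sum_mat[OF assms] by simp

lemma fourier_index:
  assumes "finite (carrier G)" "representation G d \<rho>" "a < d" "b < d"
  shows "fourier G f d \<rho> $$ (a,b) = (\<Sum>g\<in>carrier G. complex_of_real (f g) * \<rho> g $$ (a,b))"
  unfolding fourier_eq_sum_mat[OF assms(1,2)] sum_mat_index[OF assms(3,4)]
proof (rule sum.cong[OF refl])
  fix g assume "g \<in> carrier G"
  hence "\<rho> g \<in> carrier_mat d d" by (rule representation_carrier[OF assms(2)])
  thus "(complex_of_real (f g) \<cdot>\<^sub>m \<rho> g) $$ (a,b) = complex_of_real (f g) * \<rho> g $$ (a,b)"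
    using assms(3,4) by simp
qed

text \<open>
  Inserting the definition of the transform and exchanging the sums leaves the regular character at \<open>inv x
  \<otimes> g\<close> as the coefficient of \<open>h x\<close>.
\<close>

lemma fourier_inversion:
  assumes fin: "finite (carrier G)" and IR: "irreducible_representatives G r d \<rho>"
    and g: "g \<in> carrier G"
  shows "complex_of_real (h g) =
    1 / of_nat (order G) * (\<Sum>i=1..r. of_nat (d i) * mat_trace (\<rho> i (inv g) * fourier G h (d i) (\<rho> i)))"
proof -
  note rep = irreducible_representationD(1)[OF irreducible_representativesD(1)[OF IR]]
  have tr: "mat_trace (\<rho> i (inv g) * fourier G h (d i) (\<rho> i)) =
      (\<Sum>x\<in>carrier G. complex_of_real (h x) * mat_trace (\<rho> i (inv (inv x \<otimes> g))))" if i: "i \<in> {1..r}" for i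
  proof -
    have ig: "inv g \<in> carrier G" using g by simp
    note A = representation_carrier[OF rep[OF i] ig]
    note X = representation_carrier[OF rep[OF i]]
    have "\<rho> i (inv g) * fourier G h (d i) (\<rho> i) =
        sum_mat (d i) (d i) (carrier G) (\<lambda>x. \<rho> i (inv g) * (complex_of_real (h x) \<cdot>\<^sub>m \<rho> i x))"
      unfolding fourier_eq_sum_mat[OF fin rep[OF i]]
      by (rule mult_sum_mat[OF A]) (rule smult_carrier_mat[OF X])
    also have "mat_trace \<dots> = (\<Sum>x\<in>carrier G. mat_trace (\<rho> i (inv g) * (complex_of_real (h x) \<cdot>\<^sub>m \<rho> i x)))"
      by (rule mat_trace_sum_mat) (rule mult_carrier_mat[OF A smult_carrier_mat[OF X]])
    also have "\<dots> = (\<Sum>x\<in>carrier G. complex_of_real (h x) * mat_trace (\<rho> i (inv (inv x \<otimes> g))))"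
    proof (rule sum.cong[OF refl])
      fix x assume x: "x \<in> carrier G"
      have "inv (inv x \<otimes> g) = inv g \<otimes> x" using x g by (simp add: inv_mult_group)
      hence "\<rho> i (inv (inv x \<otimes> g)) = \<rho> i (inv g) * \<rho> i x"
        using representation_mult[OF rep[OF i] ig x] by simp
      moreover have "\<rho> i (inv g) * (complex_of_real (h x) \<cdot>\<^sub>m \<rho> i x) = complex_of_real (h x) \<cdot>\<^sub>m (\<rho> i (inv g) * \<rho> i x)"
        by (rule mult_smult_distrib[OF A X[OF x]])
      moreover have "mat_trace (c \<cdot>\<^sub>m (\<rho> i (inv g) * \<rho> i x)) = c * mat_trace (\<rho> i (inv g) * \<rho> i x)" for c
        using A X[OF x] by (simp add: mat_trace_def sum_distrib_left)
      ultimately show "mat_trace (\<rho> i (inv g) * (complex_of_real (h x) \<cdot>\<^sub>m \<rho> i x)) =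
          complex_of_real (h x) * mat_trace (\<rho> i (inv (inv x \<otimes> g)))" by simp
    qed
    finally show ?thesis .
  qed
  have "(\<Sum>i=1..r. of_nat (d i) * mat_trace (\<rho> i (inv g) * fourier G h (d i) (\<rho> i))) =
      (\<Sum>i=1..r. \<Sum>x\<in>carrier G. complex_of_real (h x) * (of_nat (d i) * mat_trace (\<rho> i (inv (inv x \<otimes> g)))))"
    by (intro sum.cong refl) (simp add: tr sum_distrib_left mult_ac)
  also have "\<dots> = (\<Sum>x\<in>carrier G. complex_of_real (h x) * (\<Sum>i=1..r. of_nat (d i) * mat_trace (\<rho> i (inv (inv x \<otimes> g)))))"
    by (subst sum.swap) (simp add: sum_distrib_left)
  also have "\<dots> = (\<Sum>x\<in>carrier G. if x = g then complex_of_real (h x) * of_nat (order G) else 0)"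
  proof (rule sum.cong[OF refl])
    fix x assume x: "x \<in> carrier G"
    have "inv x \<otimes> g \<in> carrier G" using x g by simp
    moreover have "inv x \<otimes> g = \<one> \<longleftrightarrow> x = g"
      using x g by (metis inv_closed inv_equality inv_inv l_inv)
    ultimately show "complex_of_real (h x) * (\<Sum>i=1..r. of_nat (d i) * mat_trace (\<rho> i (inv (inv x \<otimes> g)))) =
        (if x = g then complex_of_real (h x) * of_nat (order G) else 0)"
      using regular_character[OF fin IR] by simp
  qed
  also have "\<dots> = complex_of_real (h g) * of_nat (order G)" using fin g by simp
  finally show ?thesis using order_gt_0_iff_finite fin by simp
qed

text \<open>
  The equation for \<open>h\<close> reads \<open>h = 1 + h * p - c \<delta>\<close> with the convolution product. The
  transform is multiplicative on convolutions and takes \<open>\<delta>\<close> to the identity matrix; the assumption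
  on \<open>\<rho>\<close> says that it takes constants to zero.
\<close>

lemma fourier_of_convolution_equation:
  fixes h :: "'a \<Rightarrow> real"
  assumes fin: "finite (carrier G)" and \<rho>: "representation G d \<rho>"
    and eq: "\<And>g. g \<in> carrier G \<Longrightarrow>
      h g = 1 + (\<Sum>z\<in>carrier G. p z * h (g \<otimes> inv z)) - (if g = \<one> then c else 0)"
    and sum0: "\<And>a b. a < d \<Longrightarrow> b < d \<Longrightarrow> (\<Sum>g\<in>carrier G. \<rho> g $$ (a,b)) = 0"
  shows "fourier G h d \<rho> * (1\<^sub>m d - fourier G p d \<rho>) = (- of_real c) \<cdot>\<^sub>m 1\<^sub>m d"
proof -
  let ?H = "fourier G h d \<rho>" and ?P = "fourier G p d \<rho>"
  have H: "?H \<in> carrier_mat d d" and P: "?P \<in> carrier_mat d d"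
    using fourier_carrier[OF fin \<rho>] by auto
  have HP: "(?H * ?P) $$ (a,b) = ?H $$ (a,b) + of_real c * 1\<^sub>m d $$ (a,b)" if ab: "a < d" "b < d" for a b
  proof -
    have one: "\<rho> \<one> = 1\<^sub>m d" using \<rho> unfolding representation_iff by blast
    have "(?H * ?P) $$ (a,b) = (\<Sum>c<d. (\<Sum>x\<in>carrier G. of_real (h x) * \<rho> x $$ (a,c)) *
        (\<Sum>z\<in>carrier G. of_real (p z) * \<rho> z $$ (c,b)))"
      using ab by (simp add: mat_mult_index[OF H P] fourier_index[OF fin \<rho>])
    also have "\<dots> = (\<Sum>c<d. \<Sum>z\<in>carrier G. \<Sum>x\<in>carrier G.
        of_real (p z * h x) * (\<rho> x $$ (a,c) * \<rho> z $$ (c,b)))"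
    proof (rule sum.cong[OF refl])
      fix c
      show "(\<Sum>x\<in>carrier G. of_real (h x) * \<rho> x $$ (a,c)) * (\<Sum>z\<in>carrier G. of_real (p z) * \<rho> z $$ (c,b)) =
          (\<Sum>z\<in>carrier G. \<Sum>x\<in>carrier G. of_real (p z * h x) * (\<rho> x $$ (a,c) * \<rho> z $$ (c,b)))"
        by (subst sum.swap) (simp add: sum_product mult_ac)
    qed
    also have "\<dots> = (\<Sum>z\<in>carrier G. \<Sum>c<d. \<Sum>x\<in>carrier G.
        of_real (p z * h x) * (\<rho> x $$ (a,c) * \<rho> z $$ (c,b)))"
      by (rule sum.swap)
    also have "\<dots> = (\<Sum>z\<in>carrier G. \<Sum>x\<in>carrier G. \<Sum>c<d.
        of_real (p z * h x) * (\<rho> x $$ (a,c) * \<rho> z $$ (c,b)))"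
      by (intro sum.cong refl sum.swap)
    also have "\<dots> = (\<Sum>z\<in>carrier G. \<Sum>x\<in>carrier G. of_real (p z * h x) * \<rho> (x \<otimes> z) $$ (a,b))"
    proof (intro sum.cong refl)
      fix z x assume zx: "z \<in> carrier G" "x \<in> carrier G"
      have "\<rho> (x \<otimes> z) $$ (a,b) = (\<Sum>c<d. \<rho> x $$ (a,c) * \<rho> z $$ (c,b))"
        unfolding representation_mult[OF \<rho> zx(2,1)]
        by (rule mat_mult_index[OF representation_carrier[OF \<rho> zx(2)] representation_carrier[OF \<rho> zx(1)] ab])
      thus "(\<Sum>c<d. of_real (p z * h x) * (\<rho> x $$ (a,c) * \<rho> z $$ (c,b))) =
          of_real (p z * h x) * \<rho> (x \<otimes> z) $$ (a,b)"
        by (simp add: sum_distrib_left)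
    qed
    also have "\<dots> = (\<Sum>z\<in>carrier G. \<Sum>g\<in>carrier G. of_real (p z * h (g \<otimes> inv z)) * \<rho> g $$ (a,b))"
    proof (rule sum.cong[OF refl])
      fix z assume z: "z \<in> carrier G"
      have "(\<Sum>g\<in>carrier G. of_real (p z * h (g \<otimes> inv z)) * \<rho> g $$ (a,b)) =
          (\<Sum>x\<in>carrier G. of_real (p z * h ((x \<otimes> z) \<otimes> inv z)) * \<rho> (x \<otimes> z) $$ (a,b))"
        by (rule sum.reindex_bij_betw[OF bij_betw_mult_right[OF z], symmetric])
      also have "\<dots> = (\<Sum>x\<in>carrier G. of_real (p z * h x) * \<rho> (x \<otimes> z) $$ (a,b))"
        using z by (intro sum.cong refl) (simp add: m_assoc)
      finally show "(\<Sum>x\<in>carrier G. of_real (p z * h x) * \<rho> (x \<otimes> z) $$ (a,b)) =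
          (\<Sum>g\<in>carrier G. of_real (p z * h (g \<otimes> inv z)) * \<rho> g $$ (a,b))" ..
    qed
    also have "\<dots> = (\<Sum>g\<in>carrier G. of_real (\<Sum>z\<in>carrier G. p z * h (g \<otimes> inv z)) * \<rho> g $$ (a,b))"
      by (subst sum.swap) (simp add: sum_distrib_right)
    also have "\<dots> = (\<Sum>g\<in>carrier G. of_real (h g) * \<rho> g $$ (a,b) - \<rho> g $$ (a,b) +
        (if g = \<one> then of_real c * \<rho> g $$ (a,b) else 0))"
    proof (rule sum.cong[OF refl])
      fix g assume g: "g \<in> carrier G"
      have "(\<Sum>z\<in>carrier G. p z * h (g \<otimes> inv z)) = h g - 1 + (if g = \<one> then c else 0)"
        using eq[OF g] by simp
      show "of_real (\<Sum>z\<in>carrier G. p z * h (g \<otimes> inv z)) * \<rho> g $$ (a,b) =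
          of_real (h g) * \<rho> g $$ (a,b) - \<rho> g $$ (a,b) + (if g = \<one> then of_real c * \<rho> g $$ (a,b) else 0)"
        unfolding \<open>_ = h g - 1 + (if g = \<one> then c else 0)\<close>
        by (cases "g = \<one>") (simp_all add: algebra_simps)
    qed
    also have "\<dots> = ?H $$ (a,b) + of_real c * 1\<^sub>m d $$ (a,b)"
      using fin ab sum0[OF ab] one by (simp add: sum.distrib sum_subtractf fourier_index[OF fin \<rho>])
    finally show ?thesis .
  qed
  have "?H * (1\<^sub>m d - ?P) = ?H - ?H * ?P"
    using mult_minus_distrib_mat[OF H one_carrier_mat P] H by simp
  also have "\<dots> = (- of_real c) \<cdot>\<^sub>m 1\<^sub>m d"
  proof (rule eq_matI)
    fix a b assume "a < dim_row ((- of_real c) \<cdot>\<^sub>m 1\<^sub>m d :: complex mat)" "b < dim_col ((- of_real c) \<cdot>\<^sub>m 1\<^sub>m d :: complex mat)"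
    hence ab: "a < d" "b < d" by auto
    have "(?H - ?H * ?P) $$ (a,b) = ?H $$ (a,b) - (?H * ?P) $$ (a,b)"
      by (rule index_minus_mat(1)) (use H P ab in auto)
    also have "\<dots> = - of_real c * 1\<^sub>m d $$ (a,b)" unfolding HP[OF ab] by simp
    also have "\<dots> = ((- of_real c) \<cdot>\<^sub>m 1\<^sub>m d) $$ (a,b)" using ab by simp
    finally show "(?H - ?H * ?P) $$ (a,b) = ((- of_real c) \<cdot>\<^sub>m 1\<^sub>m d) $$ (a,b)" .
  qed (use H P in auto)
  finally show ?thesis .
qed

lemma trivial_representation_irreducible:
  assumes "trivial_representation G d \<rho>"
  shows "irreducible_representation G d \<rho>"
proof -
  have d: "d = 1" and \<rho>: "\<And>g. g \<in> carrier G \<Longrightarrow> \<rho> g = 1\<^sub>m 1"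
    using assms unfolding trivial_representation_def by auto
  have "representation G d \<rho>" unfolding representation_iff d using \<rho> by auto
  moreover have "W = {0\<^sub>v 1} \<or> W = carrier_vec 1" if W: "vec_subspace 1 W" for W
  proof (rule disjCI)
    assume ne: "W \<noteq> carrier_vec 1"
    note W' = W[unfolded vec_subspace_iff]
    have "w = 0\<^sub>v 1" if w: "w \<in> W" for w
    proof (rule ccontr)
      assume "w \<noteq> 0\<^sub>v 1"
      have wc: "w \<in> carrier_vec 1" using w W' by blast
      have w0: "w $ 0 \<noteq> 0"
      proof
        assume "w $ 0 = 0"
        hence "w = 0\<^sub>v 1" using wc by (intro eq_vecI) auto
        thus False using \<open>w \<noteq> 0\<^sub>v 1\<close> by simp
      qed
      have "u \<in> W" if u: "u \<in> carrier_vec 1" for u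
      proof -
        have "u = (u $ 0 / w $ 0) \<cdot>\<^sub>v w" using u wc w0 by (intro eq_vecI) auto
        thus ?thesis using W' w by metis
      qed
      with ne W' show False by blast
    qed
    thus "W = {0\<^sub>v 1}" using W' by blast
  qed
  ultimately show ?thesis unfolding irreducible_representation_def d by simp
qed

text \<open>
  The sum is the orthogonality relation with the only coefficient of the trivial representation, which is constantly
  one.
\<close>

lemma sum_nontrivial_irreducible:
  assumes IR: "irreducible_representatives G r d \<rho>"
    and triv: "trivial_representation G (d 1) (\<rho> 1)"
    and i: "i \<in> {1..r}" "i \<noteq> 1" and ab: "a < d i" "b < d i"
  shows "(\<Sum>g\<in>carrier G. \<rho> i g $$ (a,b)) = 0"
proof -
  have d1: "d 1 = 1" and \<rho>1: "\<And>g. g \<in> carrier G \<Longrightarrow> \<rho> 1 g = 1\<^sub>m 1"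
    using triv unfolding trivial_representation_def by auto
  have 1: "1 \<in> {1..r}" using i by auto
  note irr = irreducible_representativesD(1)[OF IR]
  have "(\<Sum>g\<in>carrier G. \<rho> 1 (inv g) $$ (0,0) * \<rho> i g $$ (a,b)) = 0"
    by (rule schur_orthogonality_distinct[OF irr[OF 1] irr[OF i(1)]
          representatives_not_isomorphic[OF IR i(1) 1 i(2)]]) (use ab d1 in auto)
  thus ?thesis using \<rho>1 by simp
qed

end

section \<open>Hitting times of finite Markov chains\<close>

text \<open>
  The probability that the chain started at \<open>x\<close> stays away from \<open>g\<close> at the times \<open>0,
  \<dots>, t\<close>, by recursion on the first step. The function \<open>taboo_prob\<close> below follows the last
  step instead, which is the form in which the Markov property delivers joint probabilities; it also records the state
  at time \<open>t\<close>.
\<close>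

fun avoid_prob :: "'s set \<Rightarrow> ('s \<Rightarrow> 's \<Rightarrow> real) \<Rightarrow> 's \<Rightarrow> nat \<Rightarrow> 's \<Rightarrow> real" where
  "avoid_prob S P g 0 x = (if x = g then 0 else 1)"
| "avoid_prob S P g (Suc t) x = (if x = g then 0 else \<Sum>z\<in>S. P x z * avoid_prob S P g t z)"

fun taboo_prob :: "'s set \<Rightarrow> ('s \<Rightarrow> 's \<Rightarrow> real) \<Rightarrow> 's \<Rightarrow> 's \<Rightarrow> nat \<Rightarrow> 's \<Rightarrow> real" where
  "taboo_prob S P g k 0 y = (if y = k \<and> y \<noteq> g then 1 else 0)"
| "taboo_prob S P g k (Suc t) y = (if y = g then 0 else \<Sum>z\<in>S. taboo_prob S P g k t z * P z y)"

lemma avoid_prob_target [simp]: "avoid_prob S P g t g = 0"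
  by (cases t) auto

lemma taboo_prob_target [simp]: "taboo_prob S P g k t g = 0"
  by (cases t) auto

text \<open>
  Cutting a path that avoids \<open>g\<close> at time \<open>t\<close> connects the two recursions. The induction
  shifts one transition at a time from the first segment to the second.
\<close>

lemma taboo_avoid_convolution:
  assumes "finite S" "k \<in> S"
  shows "(\<Sum>y\<in>S. taboo_prob S P g k t y * avoid_prob S P g m y) = avoid_prob S P g (t + m) k"
proof (induction t arbitrary: m)
  case 0
  have "(\<Sum>y\<in>S. taboo_prob S P g k 0 y * avoid_prob S P g m y) =
      (\<Sum>y\<in>S. if y = k then avoid_prob S P g m y else 0)"
    by (intro sum.cong) auto
  thus ?case using assms by simp
next
  case (Suc t)
  have "(\<Sum>y\<in>S. taboo_prob S P g k (Suc t) y * avoid_prob S P g m y) =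
      (\<Sum>y\<in>S. \<Sum>z\<in>S. taboo_prob S P g k t z * P z y * avoid_prob S P g m y)"
    by (intro sum.cong refl) (auto simp: sum_distrib_right)
  also have "\<dots> = (\<Sum>z\<in>S. taboo_prob S P g k t z * (\<Sum>y\<in>S. P z y * avoid_prob S P g m y))"
    by (subst sum.swap) (simp add: sum_distrib_left mult.assoc)
  also have "\<dots> = (\<Sum>z\<in>S. taboo_prob S P g k t z * avoid_prob S P g (Suc m) z)"
    by (intro sum.cong refl) auto
  finally show ?case using Suc.IH[of "Suc m"] by simp
qed

lemma markov_chain_measurable:
  assumes "markov_chain_from M X S P k"
  shows "X t \<in> measurable M (count_space UNIV)" "X t \<in> space M \<rightarrow> S" "prob_space M"
proof -
  have X: "X t \<in> measurable M (count_space S)" using assms unfolding markov_chain_from_def by blast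
  have "(\<lambda>x. x) \<in> measurable (count_space S) (count_space UNIV)" by simp
  from measurable_compose[OF X this] show "X t \<in> measurable M (count_space UNIV)" by simp
  show "X t \<in> space M \<rightarrow> S" using measurable_space[OF X] by auto
  show "prob_space M" using assms unfolding markov_chain_from_def by blast
qed

text \<open>
  The Markov property is stated for complete histories, so events that restrict a history only partially are split
  into finitely many single paths. The condition \<open>C\<close> leaves room for the state at the following time.
\<close>

lemma measure_sum_over_paths:
  fixes X :: "nat \<Rightarrow> 'w \<Rightarrow> 's"
  assumes mc: "markov_chain_from M X S P k" and S: "finite S"
    and C: "{\<omega> \<in> space M. C \<omega>} \<in> sets M"
  shows "measure M {\<omega> \<in> space M. C \<omega> \<and> X t \<omega> = z \<and> (\<forall>i\<le>t. X i \<omega> \<noteq> g)} =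
    (\<Sum>x | x \<in> PiE {..t} (\<lambda>_. S) \<and> x t = z \<and> (\<forall>i\<le>t. x i \<noteq> g).
      measure M {\<omega> \<in> space M. C \<omega> \<and> (\<forall>i\<le>t. X i \<omega> = x i)})"
proof -
  interpret prob_space M by (rule markov_chain_measurable(3)[OF mc])
  note [measurable] = markov_chain_measurable(1)[OF mc]
  let ?A = "{x \<in> PiE {..t} (\<lambda>_. S). x t = z \<and> (\<forall>i\<le>t. x i \<noteq> g)}"
  let ?E = "\<lambda>x. {\<omega> \<in> space M. C \<omega> \<and> (\<forall>i\<le>t. X i \<omega> = x i)}"
  have fin: "finite ?A"
    by (rule finite_subset[OF _ finite_PiE[of "{..t}" "\<lambda>_. S"]]) (use S in auto)
  have meas: "?E x \<in> sets M" for x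
  proof -
    have "{\<omega> \<in> space M. \<forall>i\<le>t. X i \<omega> = x i} \<in> sets M" by measurable
    hence "{\<omega> \<in> space M. C \<omega>} \<inter> {\<omega> \<in> space M. \<forall>i\<le>t. X i \<omega> = x i} \<in> sets M" using C by blast
    also have "{\<omega> \<in> space M. C \<omega>} \<inter> {\<omega> \<in> space M. \<forall>i\<le>t. X i \<omega> = x i} = ?E x" by auto
    finally show ?thesis .
  qed
  have disj: "disjoint_family_on ?E ?A"
    unfolding disjoint_family_on_def
  proof (intro ballI impI)
    fix x y assume x: "x \<in> ?A" and y: "y \<in> ?A" and "x \<noteq> y"
    then obtain i where "x i \<noteq> y i" by (meson ext)
    moreover have "i \<le> t"
      using x y \<open>x i \<noteq> y i\<close> by (cases "i \<le> t") (auto simp: PiE_def extensional_def)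
    ultimately show "?E x \<inter> ?E y = {}" by fastforce
  qed
  have "{\<omega> \<in> space M. C \<omega> \<and> X t \<omega> = z \<and> (\<forall>i\<le>t. X i \<omega> \<noteq> g)} = (\<Union>x\<in>?A. ?E x)"
  proof (intro Set.set_eqI iffI)
    fix \<omega> assume w: "\<omega> \<in> {\<omega> \<in> space M. C \<omega> \<and> X t \<omega> = z \<and> (\<forall>i\<le>t. X i \<omega> \<noteq> g)}"
    let ?x = "restrict (\<lambda>i. X i \<omega>) {..t}"
    have "X i \<omega> \<in> S" for i using markov_chain_measurable(2)[OF mc, of i] w by auto
    hence "?x \<in> ?A" using w by auto
    moreover have "\<omega> \<in> ?E ?x" using w by auto
    ultimately show "\<omega> \<in> (\<Union>x\<in>?A. ?E x)" by blast
  qed auto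
  thus ?thesis using finite_measure_finite_Union[OF fin _ disj] meas by (simp add: image_subset_iff)
qed

text \<open>
  For histories of probability zero, where conditioning says nothing, both sides vanish.
\<close>

lemma markov_chain_path_step:
  assumes mc: "markov_chain_from M X S P k" and x: "\<And>i. i \<le> t \<Longrightarrow> x i \<in> S" and y: "y \<in> S"
  shows "measure M {\<omega> \<in> space M. X (Suc t) \<omega> = y \<and> (\<forall>i\<le>t. X i \<omega> = x i)} =
    measure M {\<omega> \<in> space M. \<forall>i\<le>t. X i \<omega> = x i} * P (x t) y"
proof -
  interpret prob_space M by (rule markov_chain_measurable(3)[OF mc])
  note [measurable] = markov_chain_measurable(1)[OF mc]
  let ?Q = "{\<omega> \<in> space M. \<forall>i\<le>t. X i \<omega> = x i}"
  let ?R = "{\<omega> \<in> space M. X (Suc t) \<omega> = y \<and> (\<forall>i\<le>t. X i \<omega> = x i)}"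
  show ?thesis
  proof (cases "prob ?Q > 0")
    case True
    \<comment> \<open>The Markov property takes the next state from the same path.\<close>
    define x' where "x' = x(Suc t := y)"
    have x'x: "(\<forall>i\<le>t. X i \<omega> = x' i) \<longleftrightarrow> (\<forall>i\<le>t. X i \<omega> = x i)" for \<omega> by (auto simp: x'_def)
    have "\<forall>i\<le>Suc t. x' i \<in> S" using x y by (auto simp: x'_def le_Suc_eq)
    moreover have "\<P>(\<omega> in M. \<forall>i\<le>t. X i \<omega> = x' i) > 0" using True x'x by simp
    ultimately have "\<P>(\<omega> in M. X (Suc t) \<omega> = x' (Suc t) \<bar> \<forall>i\<le>t. X i \<omega> = x' i) = P (x' t) (x' (Suc t))"
      using mc unfolding markov_chain_from_def by blast
    hence "prob ?R / prob ?Q = P (x t) y" unfolding x'x by (simp add: cond_prob_def x'_def)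
    thus ?thesis using True by (simp add: field_simps)
  next
    case False
    hence Q0: "prob ?Q = 0" using measure_nonneg[of M ?Q] by linarith
    have "prob ?R \<le> prob ?Q" by (rule finite_measure_mono) auto
    hence "prob ?R = 0" using Q0 measure_nonneg[of M ?R] by linarith
    thus ?thesis using Q0 by simp
  qed
qed

lemma markov_chain_taboo_prob:
  assumes mc: "markov_chain_from M X S P k" and S: "finite S" and k: "k \<in> S" and y: "y \<in> S"
  shows "measure M {\<omega> \<in> space M. X t \<omega> = y \<and> (\<forall>i\<le>t. X i \<omega> \<noteq> g)} = taboo_prob S P g k t y"
  using y
proof (induction t arbitrary: y)
  case 0
  interpret prob_space M by (rule markov_chain_measurable(3)[OF mc])
  note [measurable] = markov_chain_measurable(1)[OF mc]
  have "AE \<omega> in M. X 0 \<omega> = k" using mc unfolding markov_chain_from_def by blast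
  hence "measure M {\<omega> \<in> space M. X 0 \<omega> = y \<and> (\<forall>i\<le>0. X i \<omega> \<noteq> g)} =
      measure M {\<omega> \<in> space M. k = y \<and> k \<noteq> g}"
    by (intro measure_eq_AE) auto
  thus ?case by (auto simp: prob_space)
next
  case (Suc t)
  interpret prob_space M by (rule markov_chain_measurable(3)[OF mc])
  note [measurable] = markov_chain_measurable(1)[OF mc]
  have C: "{\<omega> \<in> space M. X (Suc t) \<omega> = y} \<in> sets M" by measurable
  let ?A = "\<lambda>z. {x \<in> PiE {..t} (\<lambda>_. S). x t = z \<and> (\<forall>i\<le>t. x i \<noteq> g)}"
  have step: "measure M {\<omega> \<in> space M. X (Suc t) \<omega> = y \<and> X t \<omega> = z \<and> (\<forall>i\<le>t. X i \<omega> \<noteq> g)} =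
      taboo_prob S P g k t z * P z y" if z: "z \<in> S" for z
  proof -
    have "measure M {\<omega> \<in> space M. X (Suc t) \<omega> = y \<and> X t \<omega> = z \<and> (\<forall>i\<le>t. X i \<omega> \<noteq> g)} =
        (\<Sum>x\<in>?A z. measure M {\<omega> \<in> space M. X (Suc t) \<omega> = y \<and> (\<forall>i\<le>t. X i \<omega> = x i)})"
      by (rule measure_sum_over_paths[OF mc S C])
    also have "\<dots> = (\<Sum>x\<in>?A z. measure M {\<omega> \<in> space M. \<forall>i\<le>t. X i \<omega> = x i}) * P z y"
      unfolding sum_distrib_right
    proof (rule sum.cong[OF refl])
      fix x assume x: "x \<in> ?A z"
      hence "x i \<in> S" if "i \<le> t" for i using that by auto
      from markov_chain_path_step[OF mc this Suc.prems] x
      show "measure M {\<omega> \<in> space M. X (Suc t) \<omega> = y \<and> (\<forall>i\<le>t. X i \<omega> = x i)} =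
          measure M {\<omega> \<in> space M. \<forall>i\<le>t. X i \<omega> = x i} * P z y" by simp
    qed
    also have "(\<Sum>x\<in>?A z. measure M {\<omega> \<in> space M. \<forall>i\<le>t. X i \<omega> = x i}) = taboo_prob S P g k t z"
      using measure_sum_over_paths[OF mc S, of "\<lambda>_. True" t z g] Suc.IH[OF z] by simp
    finally show ?thesis .
  qed
  show ?case
  proof (cases "y = g")
    case True
    have "{\<omega> \<in> space M. X (Suc t) \<omega> = y \<and> (\<forall>i\<le>Suc t. X i \<omega> \<noteq> g)} = {}" using True by auto
    show ?thesis unfolding \<open>_ = {}\<close> using True by simp
  next
    case False
    let ?E = "\<lambda>z. {\<omega> \<in> space M. X (Suc t) \<omega> = y \<and> X t \<omega> = z \<and> (\<forall>i\<le>t. X i \<omega> \<noteq> g)}"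
    have "{\<omega> \<in> space M. X (Suc t) \<omega> = y \<and> (\<forall>i\<le>Suc t. X i \<omega> \<noteq> g)} = (\<Union>z\<in>S. ?E z)"
      using markov_chain_measurable(2)[OF mc] False by (auto simp: le_Suc_eq)
    moreover have "?E z \<in> sets M" for z by measurable
    moreover have "disjoint_family_on ?E S" by (auto simp: disjoint_family_on_def)
    ultimately have "measure M {\<omega> \<in> space M. X (Suc t) \<omega> = y \<and> (\<forall>i\<le>Suc t. X i \<omega> \<noteq> g)} = (\<Sum>z\<in>S. measure M (?E z))"
      using finite_measure_finite_Union[OF S, of ?E] by (simp add: image_subset_iff)
    thus ?thesis using False step by simp
  qed
qed

lemma markov_chain_avoid_prob:
  assumes mc: "markov_chain_from M X S P k" and S: "finite S" and k: "k \<in> S"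
  shows "measure M {\<omega> \<in> space M. \<forall>i\<le>t. X i \<omega> \<noteq> g} = avoid_prob S P g t k"
proof -
  interpret prob_space M by (rule markov_chain_measurable(3)[OF mc])
  note [measurable] = markov_chain_measurable(1)[OF mc]
  let ?E = "\<lambda>y. {\<omega> \<in> space M. X t \<omega> = y \<and> (\<forall>i\<le>t. X i \<omega> \<noteq> g)}"
  have "{\<omega> \<in> space M. \<forall>i\<le>t. X i \<omega> \<noteq> g} = (\<Union>y\<in>S. ?E y)"
    using markov_chain_measurable(2)[OF mc] by auto
  moreover have "?E y \<in> sets M" for y by measurable
  moreover have "disjoint_family_on ?E S" by (auto simp: disjoint_family_on_def)
  ultimately have "measure M {\<omega> \<in> space M. \<forall>i\<le>t. X i \<omega> \<noteq> g} = (\<Sum>y\<in>S. measure M (?E y))"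
    using finite_measure_finite_Union[OF S, of ?E] by (simp add: image_subset_iff)
  also have "\<dots> = (\<Sum>y\<in>S. taboo_prob S P g k t y * avoid_prob S P g 0 y)"
    using markov_chain_taboo_prob[OF mc S k] by (intro sum.cong) auto
  also have "\<dots> = avoid_prob S P g t k" using taboo_avoid_convolution[OF S k, of P g t 0] by simp
  finally show ?thesis .
qed

lemma less_hitting_time_iff: "enat t < hitting_time X g \<omega> \<longleftrightarrow> (\<forall>i\<le>t. X i \<omega> \<noteq> g)"
proof -
  have "enat t < hitting_time X g \<omega> \<longleftrightarrow> (\<forall>i\<in>{i. X i \<omega> = g}. enat (Suc t) \<le> enat i)"
    unfolding hitting_time_def Suc_ile_eq[symmetric] by (rule le_INF_iff)
  also have "\<dots> \<longleftrightarrow> (\<forall>i\<le>t. X i \<omega> \<noteq> g)" by (auto simp: not_less_eq_eq[symmetric])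
  finally show ?thesis .
qed

text \<open>
  This reduces measurability of a hitting time to the events that it exceeds a given natural number.
\<close>

lemma enat_eq_iff_less: "x = y \<longleftrightarrow> (\<forall>m. enat m < x \<longleftrightarrow> enat m < y)"
proof
  assume *: "\<forall>m. enat m < x \<longleftrightarrow> enat m < y"
  show "x = y"
  proof (rule ccontr)
    assume "x \<noteq> y"
    then consider "x < y" | "y < x" by fastforce
    thus False
    proof cases
      case 1
      then obtain m where "x = enat m" by (cases x) auto
      with 1 * show False by blast
    next
      case 2
      then obtain m where "y = enat m" by (cases y) auto
      with 2 * show False by blast
    qed
  qed
qed simp

text \<open>
  The expectation is the sum of the tail probabilities, and the tail event at \<open>t\<close> is that
  \<open>g\<close> is avoided up to time \<open>t\<close>.
\<close>

lemma expected_hitting_time_eq_suminf: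
  assumes mc: "markov_chain_from M X S P k" and S: "finite S" and k: "k \<in> S"
  shows "expected_hitting_time M X g = (\<Sum>t. ennreal (avoid_prob S P g t k))"
proof -
  interpret prob_space M by (rule markov_chain_measurable(3)[OF mc])
  note [measurable] = markov_chain_measurable(1)[OF mc]
  have "hitting_time X g -` {a} \<inter> space M \<in> sets M" for a
  proof -
    have "hitting_time X g -` {a} \<inter> space M =
        {\<omega> \<in> space M. \<forall>m. (\<forall>i\<le>m. X i \<omega> \<noteq> g) \<longleftrightarrow> enat m < a}"
      by (auto simp: enat_eq_iff_less[of _ a] less_hitting_time_iff)
    thus ?thesis by simp
  qed
  hence "hitting_time X g \<in> measurable M (count_space UNIV)"
    by (subst measurable_count_space_eq2_countable) auto
  from nn_integral_enat_function[OF this]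
  have "expected_hitting_time M X g = (\<Sum>t. emeasure M {\<omega> \<in> space M. \<forall>i\<le>t. X i \<omega> \<noteq> g})"
    unfolding expected_hitting_time_def less_hitting_time_iff .
  thus ?thesis
    by (simp add: emeasure_eq_measure markov_chain_avoid_prob[OF mc S k])
qed

section \<open>Mean hitting times of doubly stochastic chains\<close>

text \<open>
  Column sums equal to one mean that the uniform distribution is stationary.
\<close>

locale doubly_stochastic_chain =
  fixes S :: "'s set" and P :: "'s \<Rightarrow> 's \<Rightarrow> real"
  assumes finite_states: "finite S"
    and nonneg: "\<And>x y. P x y \<ge> 0"
    and row_sum: "\<And>x. x \<in> S \<Longrightarrow> (\<Sum>y\<in>S. P x y) = 1"
    and column_sum: "\<And>y. y \<in> S \<Longrightarrow> (\<Sum>x\<in>S. P x y) = 1"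
    and irreducible: "irreducible_chain S P"
begin

definition mean_hitting_time :: "'s \<Rightarrow> 's \<Rightarrow> real" where
  "mean_hitting_time x g = (\<Sum>t. avoid_prob S P g t x)"

lemma avoid_prob_nonneg: "avoid_prob S P g t x \<ge> 0"
  by (induction t arbitrary: x) (auto intro!: sum_nonneg mult_nonneg_nonneg nonneg)

text \<open>
  Summing over all starting states means, up to a factor, starting from the uniform distribution. By stationarity it
  is equally likely to avoid \<open>g\<close> at the times \<open>0, \<dots>, t\<close> and at the times \<open>1,
  \<dots>, t + 1\<close>; the subtracted sum accounts for the paths that begin at \<open>g\<close>.
\<close>

lemma total_avoid_prob_step:
  assumes g: "g \<in> S"
  shows "(\<Sum>x\<in>S. avoid_prob S P g (Suc t) x) =
    (\<Sum>x\<in>S. avoid_prob S P g t x) - (\<Sum>z\<in>S. P g z * avoid_prob S P g t z)"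
proof -
  have "(\<Sum>x\<in>S. avoid_prob S P g (Suc t) x) = (\<Sum>x\<in>S - {g}. \<Sum>z\<in>S. P x z * avoid_prob S P g t z)"
    by (subst sum.remove[OF finite_states g]) simp
  hence "(\<Sum>x\<in>S. avoid_prob S P g (Suc t) x) + (\<Sum>z\<in>S. P g z * avoid_prob S P g t z) =
      (\<Sum>x\<in>S. \<Sum>z\<in>S. P x z * avoid_prob S P g t z)"
    using sum.remove[OF finite_states g, of "\<lambda>x. \<Sum>z\<in>S. P x z * avoid_prob S P g t z"] by simp
  also have "\<dots> = (\<Sum>z\<in>S. (\<Sum>x\<in>S. P x z) * avoid_prob S P g t z)"
    by (subst sum.swap) (simp add: sum_distrib_right)
  also have "\<dots> = (\<Sum>z\<in>S. avoid_prob S P g t z)" using column_sum by simp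
  finally show ?thesis by simp
qed

lemma sum_return_avoid_prob:
  assumes g: "g \<in> S"
  shows "(\<Sum>t<N. \<Sum>z\<in>S. P g z * avoid_prob S P g t z) =
    real (card S) - 1 - (\<Sum>x\<in>S. avoid_prob S P g N x)"
proof (induction N)
  case 0
  have "(\<Sum>x\<in>S. avoid_prob S P g 0 x) = real (card S) - 1"
  proof -
    have "(\<Sum>x\<in>S. avoid_prob S P g 0 x) = (\<Sum>x\<in>S - {g}. 1)"
      unfolding sum.remove[OF finite_states g] by simp
    also have "\<dots> = real (card S) - 1"
      using finite_states g card_gt_0_iff[of S] by (auto simp: card_Diff_singleton of_nat_diff)
    finally show ?thesis .
  qed
  thus ?case by simp
next
  case (Suc N)
  thus ?case using total_avoid_prob_step[OF g, of N] by simp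
qed

lemma summable_return_avoid_prob:
  assumes "g \<in> S"
  shows "summable (\<lambda>t. \<Sum>z\<in>S. P g z * avoid_prob S P g t z)"
proof (rule summableI_nonneg_bounded)
  show "(\<Sum>t<N. \<Sum>z\<in>S. P g z * avoid_prob S P g t z) \<le> real (card S) - 1" for N
    using sum_return_avoid_prob[OF assms, of N] sum_nonneg[of S "avoid_prob S P g N"] avoid_prob_nonneg
    by simp
qed (auto intro!: sum_nonneg mult_nonneg_nonneg nonneg avoid_prob_nonneg)

text \<open>
  If \<open>x\<close> is not the target, avoiding \<open>g\<close> from \<open>x\<close> includes stepping to
  \<open>z\<close> and avoiding it from there. If \<open>x = g\<close>, the finiteness of the mean return time takes
  the place of this argument.
\<close>

lemma summable_avoid_prob_successor:
  assumes g: "g \<in> S" and x: "x \<in> S" and z: "z \<in> S" and Pxz: "P x z > 0"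
    and sx: "summable (\<lambda>t. avoid_prob S P g t x)"
  shows "summable (\<lambda>t. avoid_prob S P g t z)"
proof -
  have "summable (\<lambda>t. \<Sum>z\<in>S. P x z * avoid_prob S P g t z)"
  proof (cases "x = g")
    case True
    thus ?thesis using summable_return_avoid_prob[OF g] by simp
  next
    case False
    have "summable (\<lambda>t. avoid_prob S P g (Suc t) x)" using sx by (subst summable_Suc_iff)
    thus ?thesis using False by simp
  qed
  hence "summable (\<lambda>t. inverse (P x z) * (\<Sum>z\<in>S. P x z * avoid_prob S P g t z))"
    by (rule summable_mult)
  moreover have "norm (avoid_prob S P g t z) \<le> inverse (P x z) * (\<Sum>z\<in>S. P x z * avoid_prob S P g t z)" for t
  proof -
    have "P x z * avoid_prob S P g t z \<le> (\<Sum>z\<in>S. P x z * avoid_prob S P g t z)"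
      by (rule member_le_sum[OF z]) (auto intro!: mult_nonneg_nonneg nonneg avoid_prob_nonneg finite_states)
    thus ?thesis using Pxz avoid_prob_nonneg[of g t z] by (simp add: field_simps)
  qed
  ultimately show ?thesis by (rule summable_comparison_test'[where N = 0])
qed

text \<open>
  Starting from \<open>g\<close>, whose own hitting time is zero, finiteness spreads along every transition of
  positive probability.
\<close>

lemma summable_avoid_prob:
  assumes g: "g \<in> S" and y: "y \<in> S"
  shows "summable (\<lambda>t. avoid_prob S P g t y)"
proof -
  have reach: "summable (\<lambda>t. avoid_prob S P g t y)"
    if "x \<in> S" "step_prob S P m x y > 0" "summable (\<lambda>t. avoid_prob S P g t x)" for x m
    using that
  proof (induction m arbitrary: x)
    case 0
    thus ?case by (auto split: if_splits)
  next
    case (Suc m)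
    have "\<exists>z\<in>S. P x z * step_prob S P m z y > 0"
    proof (rule ccontr)
      assume "\<not> ?thesis"
      hence "step_prob S P (Suc m) x y \<le> 0" by (auto intro!: sum_nonpos simp: not_less)
      with Suc.prems show False by simp
    qed
    then obtain z where z: "z \<in> S" "P x z * step_prob S P m z y > 0" by blast
    hence "P x z > 0" "step_prob S P m z y > 0"
      using nonneg[of x z] by (auto simp: zero_less_mult_iff)
    thus ?case
      using Suc.IH[OF z(1)] summable_avoid_prob_successor[OF g Suc.prems(1) z(1) _ Suc.prems(3)] by blast
  qed
  obtain m where "step_prob S P m g y > 0"
    using irreducible g y unfolding irreducible_chain_def by blast
  from reach[OF g this] show ?thesis by simp
qed

text \<open>
  Kac's formula: one step away from \<open>g\<close> plus this sum is the mean return time, the reciprocal of the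
  stationary probability. Finiteness of all mean hitting times makes the remainder in
  \<open>sum_return_avoid_prob\<close> vanish in the limit.
\<close>

lemma mean_return_time:
  assumes g: "g \<in> S"
  shows "(\<Sum>z\<in>S. P g z * mean_hitting_time z g) = real (card S) - 1"
proof -
  let ?r = "\<lambda>t. \<Sum>z\<in>S. P g z * avoid_prob S P g t z"
  have "(\<lambda>N. avoid_prob S P g N x) \<longlonglongrightarrow> 0" if "x \<in> S" for x
    by (rule summable_LIMSEQ_zero[OF summable_avoid_prob[OF g that]])
  hence "(\<lambda>N. \<Sum>x\<in>S. avoid_prob S P g N x) \<longlonglongrightarrow> (\<Sum>x\<in>S. 0)"
    by (rule tendsto_sum)
  hence "(\<lambda>N. real (card S) - 1 - (\<Sum>x\<in>S. avoid_prob S P g N x)) \<longlonglongrightarrow> real (card S) - 1 - 0"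
    by (intro tendsto_diff tendsto_const) simp
  hence "(\<lambda>N. \<Sum>t<N. ?r t) \<longlonglongrightarrow> real (card S) - 1"
    unfolding sum_return_avoid_prob[OF g] by simp
  hence "?r sums (real (card S) - 1)" unfolding sums_def .
  moreover have "?r sums (\<Sum>z\<in>S. P g z * mean_hitting_time z g)"
    unfolding mean_hitting_time_def
    by (intro sums_sum sums_mult summable_sums summable_avoid_prob g)
  ultimately show ?thesis by (metis sums_unique2)
qed

text \<open>
  The correction term reconciles the first-step equation at \<open>x = g\<close>, where its left-hand side is zero and
  the rest of its right-hand side is the mean return time.
\<close>

lemma mean_hitting_time_first_step:
  assumes g: "g \<in> S" and x: "x \<in> S"
  shows "mean_hitting_time x g =
    1 + (\<Sum>z\<in>S. P x z * mean_hitting_time z g) - (if x = g then real (card S) else 0)"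
proof (cases "x = g")
  case True
  have "mean_hitting_time g g = 0" by (simp add: mean_hitting_time_def)
  thus ?thesis using True mean_return_time[OF g] by simp
next
  case False
  have "(\<lambda>t. avoid_prob S P g (Suc t) x) sums (\<Sum>z\<in>S. P x z * mean_hitting_time z g)"
    unfolding mean_hitting_time_def using False
    by (simp, intro sums_sum sums_mult summable_sums summable_avoid_prob g)
  hence "(\<lambda>t. avoid_prob S P g t x) sums ((\<Sum>z\<in>S. P x z * mean_hitting_time z g) + avoid_prob S P g 0 x)"
    by (rule sums_Suc)
  thus ?thesis using False by (simp add: mean_hitting_time_def sums_unique[symmetric])
qed

lemma expected_hitting_time_eq_mean:
  assumes "markov_chain_from M X S P k" "k \<in> S" "g \<in> S"
  shows "expected_hitting_time M X g = ennreal (mean_hitting_time k g)"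
  unfolding expected_hitting_time_eq_suminf[OF assms(1) finite_states assms(2)] mean_hitting_time_def
  by (rule suminf_ennreal2[OF avoid_prob_nonneg summable_avoid_prob[OF assms(3,2)]])

end

section \<open>Hitting times of random walks on groups\<close>

context group
begin

lemma bij_betw_mult_inv:
  assumes "x \<in> carrier G"
  shows "bij_betw (\<lambda>g. x \<otimes> inv g) (carrier G) (carrier G)"
  using assms
  by (intro bij_betwI[where g = "\<lambda>g. inv g \<otimes> x"]) (auto simp: inv_mult_group m_assoc[symmetric] m_assoc)

text \<open>
  For fixed \<open>x\<close> as well as for fixed \<open>y\<close>, the element \<open>y \<otimes> inv x\<close> runs
  through the whole group.
\<close>

lemma walk_doubly_stochastic:
  assumes fin: "finite (carrier G)" and p: "set_pmf p \<subseteq> carrier G"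
    and irr: "irreducible_chain (carrier G) (walk_trans G p)"
  shows "doubly_stochastic_chain (carrier G) (walk_trans G p)"
proof
  have total: "(\<Sum>g\<in>carrier G. pmf p g) = 1" by (rule sum_pmf_eq_1[OF fin p])
  show "(\<Sum>y\<in>carrier G. walk_trans G p x y) = 1" if "x \<in> carrier G" for x
    using sum.reindex_bij_betw[OF bij_betw_mult_right[of "inv x"], of "pmf p"] that total
    by (simp add: walk_trans_def)
  show "(\<Sum>x\<in>carrier G. walk_trans G p x y) = 1" if "y \<in> carrier G" for y
    using sum.reindex_bij_betw[OF bij_betw_mult_inv[OF that], of "pmf p"] total
    by (simp add: walk_trans_def)
qed (use fin irr in \<open>auto simp: walk_trans_def\<close>)

lemma walk_trans_right_invariant:
  assumes "x \<in> carrier G" "y \<in> carrier G" "k \<in> carrier G"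
  shows "walk_trans G p (x \<otimes> k) (y \<otimes> k) = walk_trans G p x y"
proof -
  have "k \<otimes> (inv k \<otimes> inv x) = inv x" using assms by (simp add: m_assoc[symmetric])
  thus ?thesis using assms by (simp add: walk_trans_def inv_mult_group m_assoc)
qed

lemma avoid_prob_walk_right_invariant:
  assumes k: "k \<in> carrier G" and g: "g \<in> carrier G" and x: "x \<in> carrier G"
  shows "avoid_prob (carrier G) (walk_trans G p) (g \<otimes> k) t (x \<otimes> k) =
    avoid_prob (carrier G) (walk_trans G p) g t x"
  using x
proof (induction t arbitrary: x)
  case 0
  thus ?case using k g by simp
next
  case (Suc t)
  have "(\<Sum>z\<in>carrier G. walk_trans G p (x \<otimes> k) z * avoid_prob (carrier G) (walk_trans G p) (g \<otimes> k) t z) =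
      (\<Sum>z\<in>carrier G. walk_trans G p (x \<otimes> k) (z \<otimes> k) * avoid_prob (carrier G) (walk_trans G p) (g \<otimes> k) t (z \<otimes> k))"
    by (rule sum.reindex_bij_betw[OF bij_betw_mult_right[OF k], symmetric])
  also have "\<dots> = (\<Sum>z\<in>carrier G. walk_trans G p x z * avoid_prob (carrier G) (walk_trans G p) g t z)"
    using Suc k by (intro sum.cong refl) (simp add: walk_trans_right_invariant)
  finally show ?case using Suc.prems k g by simp
qed

lemma mean_hitting_time_walk_right_invariant:
  assumes "finite (carrier G)" "set_pmf p \<subseteq> carrier G"
    and "irreducible_chain (carrier G) (walk_trans G p)"
    and "k \<in> carrier G" "g \<in> carrier G" "x \<in> carrier G"
  shows "doubly_stochastic_chain.mean_hitting_time (carrier G) (walk_trans G p) (x \<otimes> k) (g \<otimes> k) =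
    doubly_stochastic_chain.mean_hitting_time (carrier G) (walk_trans G p) x g"
proof -
  interpret doubly_stochastic_chain "carrier G" "walk_trans G p"
    by (rule walk_doubly_stochastic[OF assms(1-3)])
  show ?thesis unfolding mean_hitting_time_def using avoid_prob_walk_right_invariant[OF assms(4-6)] by simp
qed

end

theorem theorem3p5:
  fixes G :: "('a, 'b) monoid_scheme" (structure)
    and n :: nat
    and p :: "'a pmf"
    and M :: "'a \<Rightarrow> 'w measure"
    and X :: "'a \<Rightarrow> nat \<Rightarrow> 'w \<Rightarrow> 'a"
    and h :: "'a \<Rightarrow> real"
    and r :: nat
    and d :: "nat \<Rightarrow> nat"
    and \<rho> :: "nat \<Rightarrow> 'a \<Rightarrow> complex mat"
  assumes "group G" and "finite (carrier G)" and "order G = n"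
    and "set_pmf p \<subseteq> carrier G"
    and "irreducible_chain (carrier G) (walk_trans G p)"
    and "\<And>k. k \<in> carrier G \<Longrightarrow>
           markov_chain_from (M k) (X k) (carrier G) (walk_trans G p) k"
    and "\<And>g. g \<in> carrier G \<Longrightarrow>
           h g = enn2real (expected_hitting_time (M \<one>) (X \<one>) g)"
    and "irreducible_representatives G r d \<rho>"
    and "trivial_representation G (d 1) (\<rho> 1)"
  shows "(\<forall>g\<in>carrier G. \<forall>k\<in>carrier G.
            expected_hitting_time (M k) (X k) (g \<otimes> k) = ennreal (h g)) \<and>
         (\<forall>i\<in>{1..r}. i \<noteq> 1 \<longrightarrow>
            1\<^sub>m (d i) - fourier G (pmf p) (d i) (\<rho> i) \<in> Units (cmat_ring (d i)) \<and>
            fourier G h (d i) (\<rho> i) =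
              (- of_nat n) \<cdot>\<^sub>m
                (inv\<^bsub>cmat_ring (d i)\<^esub> (1\<^sub>m (d i) - fourier G (pmf p) (d i) (\<rho> i)))) \<and>
         fourier G h (d 1) (\<rho> 1) =
           (- (\<Sum>i=2..r. of_nat (d i) * mat_trace (fourier G h (d i) (\<rho> i)))) \<cdot>\<^sub>m 1\<^sub>m 1 \<and>
         (\<forall>g\<in>carrier G.
            complex_of_real (h g) =
              1 / of_nat n *
                (\<Sum>i=1..r. of_nat (d i) * mat_trace (\<rho> i (inv g) * fourier G h (d i) (\<rho> i))))"
proof -
  interpret group G by fact
  interpret walk: doubly_stochastic_chain "carrier G" "walk_trans G p"
    by (rule walk_doubly_stochastic[OF assms(2,4,5)])
  note fin = assms(2) and IR = assms(8) and triv = assms(9)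
  note shift = mean_hitting_time_walk_right_invariant[OF assms(2,4,5)]
  note irr = irreducible_representativesD(1)[OF IR]
  note rep = irreducible_representationD(1)[OF irr]
  have mht_nonneg: "walk.mean_hitting_time x g \<ge> 0" if "x \<in> carrier G" "g \<in> carrier G" for x g
    unfolding walk.mean_hitting_time_def
    by (intro suminf_nonneg walk.summable_avoid_prob walk.avoid_prob_nonneg that)
  have h: "h g = walk.mean_hitting_time \<one> g" if g: "g \<in> carrier G" for g
    using assms(7)[OF g] walk.expected_hitting_time_eq_mean[OF assms(6)[OF one_closed] one_closed g]
      mht_nonneg[OF one_closed g] by simp
  have hk: "walk.mean_hitting_time k (g \<otimes> k) = h g" if "g \<in> carrier G" "k \<in> carrier G" for g k
    using shift[of k g \<one>] h that by simp
  have n: "n = card (carrier G)" "n > 0"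
    using assms(3) fin order_gt_0_iff_finite by (auto simp: order_def)
  have h_eq: "h g = 1 + (\<Sum>z\<in>carrier G. pmf p z * h (g \<otimes> inv z)) - (if g = \<one> then real n else 0)"
    if g: "g \<in> carrier G" for g
  proof -
    have "h g = 1 + (\<Sum>z\<in>carrier G. walk_trans G p \<one> z * walk.mean_hitting_time z g) -
        (if g = \<one> then real n else 0)"
      using walk.mean_hitting_time_first_step[OF g one_closed] h[OF g] n(1) by auto
    also have "(\<Sum>z\<in>carrier G. walk_trans G p \<one> z * walk.mean_hitting_time z g) =
        (\<Sum>z\<in>carrier G. pmf p z * h (g \<otimes> inv z))"
    proof (rule sum.cong[OF refl])
      fix z assume z: "z \<in> carrier G"
      have "walk.mean_hitting_time z g = h (g \<otimes> inv z)"
        using hk[of "g \<otimes> inv z" z] g z by (simp add: m_assoc)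
      thus "walk_trans G p \<one> z * walk.mean_hitting_time z g = pmf p z * h (g \<otimes> inv z)"
        using z by (simp add: walk_trans_def)
    qed
    finally show ?thesis .
  qed
  have inversion: "complex_of_real (h g) =
      1 / of_nat n * (\<Sum>i=1..r. of_nat (d i) * mat_trace (\<rho> i (inv g) * fourier G h (d i) (\<rho> i)))"
    if g: "g \<in> carrier G" for g
    using fourier_inversion[OF fin IR g, of h] assms(3) by simp
  have "expected_hitting_time (M k) (X k) (g \<otimes> k) = ennreal (h g)"
    if g: "g \<in> carrier G" and k: "k \<in> carrier G" for g k
    using walk.expected_hitting_time_eq_mean[OF assms(6)[OF k] k, of "g \<otimes> k"] hk[OF g k] g k by simp
  moreover have "1\<^sub>m (d i) - fourier G (pmf p) (d i) (\<rho> i) \<in> Units (cmat_ring (d i)) \<and>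
      fourier G h (d i) (\<rho> i) =
        (- of_nat n) \<cdot>\<^sub>m (inv\<^bsub>cmat_ring (d i)\<^esub> (1\<^sub>m (d i) - fourier G (pmf p) (d i) (\<rho> i)))"
    if i: "i \<in> {1..r}" "i \<noteq> 1" for i
  proof -
    interpret R: ring "cmat_ring (d i)" by (rule ring_mat)
    let ?H = "fourier G h (d i) (\<rho> i)"
    define Q where "Q = 1\<^sub>m (d i) - fourier G (pmf p) (d i) (\<rho> i)"
    define S where "S = (- 1 / of_nat n) \<cdot>\<^sub>m ?H"
    have H: "?H \<in> carrier_mat (d i) (d i)" by (rule fourier_carrier[OF fin rep[OF i(1)]])
    have Q: "Q \<in> carrier_mat (d i) (d i)"
      unfolding Q_def by (rule minus_carrier_mat[OF fourier_carrier[OF fin rep[OF i(1)]]])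
    have S: "S \<in> carrier_mat (d i) (d i)" unfolding S_def using H by simp
    have HQ: "?H * Q = (- of_nat n) \<cdot>\<^sub>m 1\<^sub>m (d i)"
      using fourier_of_convolution_equation[OF fin rep[OF i(1)] h_eq sum_nontrivial_irreducible[OF IR triv i]]
      unfolding Q_def by simp
    have SQ: "S * Q = 1\<^sub>m (d i)"
      unfolding S_def mult_smult_assoc_mat[OF H Q] HQ using n(2) by (intro eq_matI) auto
    have QS: "Q * S = 1\<^sub>m (d i)" by (rule mat_mult_left_right_inverse[OF S Q SQ])
    have "Q \<in> Units (cmat_ring (d i))" unfolding cmat_Units_iff using Q S SQ QS by blast
    moreover have "S = inv\<^bsub>cmat_ring (d i)\<^esub> Q"
      using R.inv_unique'[of Q S] Q S SQ QS by (simp add: ring_mat_simps)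
    moreover have "?H = (- of_nat n) \<cdot>\<^sub>m S"
      unfolding S_def using H n(2) by (intro eq_matI) auto
    ultimately show ?thesis unfolding Q_def by simp
  qed
  moreover have "fourier G h (d 1) (\<rho> 1) =
      (- (\<Sum>i=2..r. of_nat (d i) * mat_trace (fourier G h (d i) (\<rho> i)))) \<cdot>\<^sub>m 1\<^sub>m 1"
  proof -
    have d1: "d 1 = 1" using triv unfolding trivial_representation_def by blast
    have irr1: "irreducible_representation G (d 1) (\<rho> 1)" by (rule trivial_representation_irreducible[OF triv])
    have r: "1 \<le> r" using irreducible_representativesD(2)[OF IR irr1] by auto
    let ?t = "\<lambda>i. of_nat (d i) * mat_trace (fourier G h (d i) (\<rho> i)) :: complex"
    have H1: "fourier G h (d 1) (\<rho> 1) \<in> carrier_mat 1 1"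
      using fourier_carrier[OF fin irreducible_representationD(1)[OF irr1], of h] d1 by simp
    have one: "\<rho> i (inv \<one>) * fourier G h (d i) (\<rho> i) = fourier G h (d i) (\<rho> i)" if i: "i \<in> {1..r}" for i
    proof -
      have "\<rho> i \<one> = 1\<^sub>m (d i)" using rep[OF i] unfolding representation_iff by blast
      thus ?thesis using fourier_carrier[OF fin rep[OF i], of h] by simp
    qed
    have "h \<one> = 0" using h[OF one_closed] by (simp add: walk.mean_hitting_time_def)
    hence "(\<Sum>i=1..r. ?t i) = 0"
      using inversion[OF one_closed] n(2) one by simp
    hence "?t 1 + (\<Sum>i=2..r. ?t i) = 0"
      using sum.atLeast_Suc_atMost[OF r, of ?t] by (simp add: numeral_2_eq_2)
    moreover have "?t 1 = fourier G h (d 1) (\<rho> 1) $$ (0,0)"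
      using H1 d1 by (simp add: mat_trace_def)
    ultimately have "fourier G h (d 1) (\<rho> 1) $$ (0,0) = - (\<Sum>i=2..r. ?t i)"
      by (simp add: eq_neg_iff_add_eq_0)
    thus ?thesis using H1 by (intro eq_matI) auto
  qed
  ultimately show ?thesis using inversion by blast
qed

end
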